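(* There is an algorithm that, given an undirected graph $G$ on $n$ vertices and an integer $k$, decides in time $7^k\cdot n^{O(1)}$ whether there is a set $S\subseteq V(G)$ of size at most $k$ such that every connected component of $G-S$ is either a claw-free graph or a triangle-free graph.
   Context: All graphs are finite, simple and undirected. The claw is $K_{1,3}$, the triangle is $C_3$, and claw-free (resp. triangle-free) means containing no claw (resp. triangle) as an induced subgraph. Different components of $G-S$ may be of different types. *)

theory Defs
  imports "Graph_Theory.Graph_Theory" "HOL-Library.Log_Nat"
begin

section \<open>Model of computation\<close>

text \<open>
  Algorithms are while-programs of a random access machine under the logarithmic cost criterion.
  A store consists of arrays of natural numbers, indexed by natural numbers; a scalar register
  is cell 0 of an array. The arithmetic operations are addition and
  truncated subtraction, and each operation is charged the binary length of the numbers it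
  handles, so that large numbers cannot be used to do much work in one step.
\<close>

type_synonym store = "string \<Rightarrow> nat \<Rightarrow> nat"

datatype expr =
    Const nat
  | Load string expr
  | Add expr expr
  | Sub expr expr

primrec val :: "expr \<Rightarrow> store \<Rightarrow> nat" where
  "val (Const v) s = v"
| "val (Load a e) s = s a (val e s)"
| "val (Add e1 e2) s = val e1 s + val e2 s"
| "val (Sub e1 e2) s = val e1 s - val e2 s"

text \<open>\<^term>\<open>floorlog 2 v\<close> is the number of binary digits of \<^term>\<open>v\<close> (0 for \<^term>\<open>v = 0\<close>).\<close>

definition log_cost :: "nat \<Rightarrow> nat" where
  "log_cost v = 1 + floorlog 2 v"

text \<open>Every node of an expression pays for its value; an array access thereby also pays for its
  address, which is the value of the index expression.\<close>

primrec expr_cost :: "expr \<Rightarrow> store \<Rightarrow> nat" where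
  "expr_cost (Const v) s = log_cost v"
| "expr_cost (Load a e) s = expr_cost e s + log_cost (s a (val e s))"
| "expr_cost (Add e1 e2) s = expr_cost e1 s + expr_cost e2 s + log_cost (val e1 s + val e2 s)"
| "expr_cost (Sub e1 e2) s = expr_cost e1 s + expr_cost e2 s + log_cost (val e1 s - val e2 s)"

datatype prog =
    Skip
  | Store string expr expr
  | Seq prog prog
  | IfNZ expr prog prog
  | WhileNZ expr prog

text \<open>\<open>exec p s t s'\<close>: started in store \<open>s\<close>, the program \<open>p\<close> halts in store \<open>s'\<close> after time
  \<open>t\<close>. Tests succeed on nonzero values.\<close>

inductive exec :: "prog \<Rightarrow> store \<Rightarrow> nat \<Rightarrow> store \<Rightarrow> bool" where
  Skip: "exec Skip s 1 s"
| Store: "exec (Store a e1 e2) s (1 + expr_cost e1 s + expr_cost e2 s)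
            (s(a := (s a)(val e1 s := val e2 s)))"
| Seq: "\<lbrakk>exec p s t1 s1; exec q s1 t2 s2\<rbrakk> \<Longrightarrow> exec (Seq p q) s (t1 + t2) s2"
| IfTrue: "\<lbrakk>val e s \<noteq> 0; exec p s t s'\<rbrakk> \<Longrightarrow> exec (IfNZ e p q) s (1 + expr_cost e s + t) s'"
| IfFalse: "\<lbrakk>val e s = 0; exec q s t s'\<rbrakk> \<Longrightarrow> exec (IfNZ e p q) s (1 + expr_cost e s + t) s'"
| WhileFalse: "val e s = 0 \<Longrightarrow> exec (WhileNZ e p) s (1 + expr_cost e s) s"
| WhileTrue: "\<lbrakk>val e s \<noteq> 0; exec p s t1 s1; exec (WhileNZ e p) s1 t2 s2\<rbrakk>
    \<Longrightarrow> exec (WhileNZ e p) s (1 + expr_cost e s + t1 + t2) s2"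

inductive_cases exec_SkipE: "exec Skip s t s'"
inductive_cases exec_StoreE: "exec (Store a e1 e2) s t s'"
inductive_cases exec_SeqE: "exec (Seq p q) s t s'"
inductive_cases exec_IfE: "exec (IfNZ e p q) s t s'"
inductive_cases exec_WhileE: "exec (WhileNZ e p) s t s'"

lemma exec_deterministic:
  "exec p s t s' \<Longrightarrow> exec p s u s'' \<Longrightarrow> u = t \<and> s'' = s'"
proof (induction arbitrary: u s'' rule: exec.induct)
  case (Skip s) then show ?case by (rule exec_SkipE) simp
next
  case (Store a e1 e2 s) then show ?case by (rule exec_StoreE) simp
next
  case (Seq p s t1 s1 q t2 s2)
  from Seq.prems obtain u1 r1 u2
    where "exec p s u1 r1" "exec q r1 u2 s''" "u = u1 + u2"
    by (rule exec_SeqE)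
  with Seq.IH show ?case by metis
next
  case (IfTrue e s p t s' q)
  from IfTrue.prems obtain u' where "exec p s u' s''" "u = 1 + expr_cost e s + u'"
    by (rule exec_IfE) (use IfTrue.hyps in auto)
  with IfTrue.IH show ?case by metis
next
  case (IfFalse e s q t s' p)
  from IfFalse.prems obtain u' where "exec q s u' s''" "u = 1 + expr_cost e s + u'"
    by (rule exec_IfE) (use IfFalse.hyps in auto)
  with IfFalse.IH show ?case by metis
next
  case (WhileFalse e s p)
  from WhileFalse.prems show ?case
    by (rule exec_WhileE) (use WhileFalse.hyps in auto)
next
  case (WhileTrue e s p t1 s1 t2 s2)
  from WhileTrue.prems obtain u1 r1 u2
    where "exec p s u1 r1" "exec (WhileNZ e p) r1 u2 s''" "u = 1 + expr_cost e s + u1 + u2"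
    by (rule exec_WhileE) (use WhileTrue.hyps in auto)
  with WhileTrue.IH show ?case by metis
qed

text \<open>Since execution is deterministic, the halting run below is the only run. The answer is read
  off the register \<open>out\<close>.\<close>

definition decides_within :: "prog \<Rightarrow> store \<Rightarrow> nat \<Rightarrow> bool \<Rightarrow> bool" where
  "decides_within p s T answer \<longleftrightarrow>
     (\<exists>t s'. exec p s t s' \<and> t \<le> T \<and> (s' ''out'' 0 \<noteq> 0 \<longleftrightarrow> answer))"

text \<open>The input is a graph with vertex set \<open>{..<n}\<close>, given by its adjacency matrix in row-major
  order, and a number \<open>k\<close>. All other cells are initially 0.\<close>

definition graph_input :: "nat \<Rightarrow> nat pair_pre_digraph \<Rightarrow> nat \<Rightarrow> store" where
  "graph_input n G k = (\<lambda>a i.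
     if a = ''n'' \<and> i = 0 then n
     else if a = ''k'' \<and> i = 0 then k
     else if a = ''adj'' \<and> i < n * n \<and> (i div n, i mod n) \<in> parcs G then 1
     else 0)"


section \<open>Deletion to claw-free or triangle-free components\<close>

text \<open>Undirected graphs are symmetric digraphs, as in \<^theory>\<open>Graph_Theory.Digraph\<close>.\<close>

definition claw_free :: "('a, 'b) pre_digraph \<Rightarrow> bool" where
  "claw_free G \<longleftrightarrow> \<not> (\<exists>H. induced_subgraph H G \<and> K\<^bsub>1,3\<^esub> H)"

text \<open>The triangle is \<open>C\<^sub>3 = K\<^sub>3\<close>.\<close>

definition triangle_free :: "('a, 'b) pre_digraph \<Rightarrow> bool" where
  "triangle_free G \<longleftrightarrow> \<not> (\<exists>H. induced_subgraph H G \<and> K\<^bsub>3\<^esub> H)"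

text \<open>In a symmetric digraph the strongly connected components \<^const>\<open>pre_digraph.sccs\<close>, as
  induced subgraphs, are exactly the connected components.\<close>

definition claw_or_triangle_free_deletion_set :: "('a, 'b) pre_digraph \<Rightarrow> 'a set \<Rightarrow> bool" where
  "claw_or_triangle_free_deletion_set G S \<longleftrightarrow>
     S \<subseteq> verts G \<and>
     (\<forall>H \<in> pre_digraph.sccs (G \<restriction> (verts G - S)). claw_free H \<or> triangle_free H)"

end

theory Submission
  imports Defs
begin

text \<open>
  Take a triangle and a claw in the same component at minimal distance. An inner vertex of a shortest
  path between them lies in no triangle and in no claw, hence has degree at most two. A solution
  that avoids all seven vertices must cut this path, and then the cut vertex can be replaced by the
  end of the path in the triangle. So some optimal solution contains one of the seven vertices, and
  branching on them gives a search tree with \<open>O(7\<^sup>k)\<close> nodes. All that is used of the pair is that it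
  is joined by a path with inner vertices of degree at most two, a relation that is computed by
  Warshall's algorithm; the seven vertices are then found by exhaustive search.

  The program keeps the open nodes of the search tree, sets of surviving vertices with a remaining
  budget, on a stack. A potential that charges each budget with the size of its search
  tree bounds the number of rounds by \<open>2 \<cdot> 7\<^sup>k\<close>, and each round takes polynomial time. If \<open>k \<ge> n\<close>,
  the answer is yes at once, so that otherwise all addresses have \<open>O(n)\<close> bits.
\<close>

section \<open>Triangles and claws joined by a thin walk\<close>

text \<open>Closeness and thinness play different roles. A closest pair only shows that a thinly
  joined pair exists whenever the graph is not yet good. The exchange argument applies to every
  thinly joined pair, because it passes to a shortest thin walk between the same seven vertices. So
  the program never compares distances and may branch on any pair it finds. Using walks instead of
  paths spares all distinctness conditions: walks can be concatenated, and shortness supplies what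
  is needed of a path.

  On the machine side, the cost of an operation depends on the numbers it handles, and exact step
  counts would be unmanageable. Each program therefore gets a syntactic exponent \<open>d\<close>
  and runs in time \<open>(n + 2) ^ d\<close> as long as all cells stay below a fixed bound with
  \<open>O(n)\<close> bits. This covers loops of at most \<open>n\<close> rounds; only the loop over
  the nodes of the search tree needs a potential of its own.\<close>

locale sym_irrefl =
  fixes E :: "'a \<Rightarrow> 'a \<Rightarrow> bool"
  assumes E_sym: "E x y \<Longrightarrow> E y x" and E_irrefl: "\<not> E x x"
begin

definition adj :: "'a set \<Rightarrow> 'a \<Rightarrow> 'a \<Rightarrow> bool" where
  "adj X x y \<longleftrightarrow> x \<in> X \<and> y \<in> X \<and> E x y"

abbreviation conn :: "'a set \<Rightarrow> 'a \<Rightarrow> 'a \<Rightarrow> bool" where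
  "conn X \<equiv> (adj X)\<^sup>*\<^sup>*"

definition tri :: "'a set \<Rightarrow> 'a \<Rightarrow> 'a \<Rightarrow> 'a \<Rightarrow> bool" where
  "tri X a b c \<longleftrightarrow> adj X a b \<and> adj X b c \<and> adj X a c"

definition claw :: "'a set \<Rightarrow> 'a \<Rightarrow> 'a \<Rightarrow> 'a \<Rightarrow> 'a \<Rightarrow> bool" where
  "claw X c x y z \<longleftrightarrow> adj X c x \<and> adj X c y \<and> adj X c z \<and> x \<noteq> y \<and> y \<noteq> z \<and> x \<noteq> z
     \<and> \<not> E x y \<and> \<not> E y z \<and> \<not> E x z"

text \<open>Components need not be mentioned: triangles and claws are connected, so they share a
  component as soon as one vertex of each is joined by \<open>conn\<close>.\<close>

definition good :: "'a set \<Rightarrow> bool" where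
  "good X \<longleftrightarrow> \<not> (\<exists>t u v c x y z. tri X t u v \<and> claw X c x y z \<and> conn X t c)"

definition thin :: "'a set \<Rightarrow> 'a \<Rightarrow> bool" where
  "thin X w \<longleftrightarrow> w \<in> X \<and> \<not> (\<exists>a b c. adj X w a \<and> adj X w b \<and> adj X w c \<and> a \<noteq> b \<and> b \<noteq> c \<and> a \<noteq> c)"

definition thin_walk :: "'a set \<Rightarrow> (nat \<Rightarrow> 'a) \<Rightarrow> nat \<Rightarrow> bool" where
  "thin_walk X p m \<longleftrightarrow> (\<forall>i<m. adj X (p i) (p (Suc i))) \<and> (\<forall>i. 0 < i \<and> i < m \<longrightarrow> thin X (p i))"

lemma adj_sym: "adj X x y \<Longrightarrow> adj X y x"
  by (auto simp: adj_def E_sym)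

lemma conn_sym: "conn X x y \<Longrightarrow> conn X y x"
  by (metis adj_sym sympI symp_rtranclp sympD)

lemma adj_mono: "adj X x y \<Longrightarrow> X \<subseteq> Y \<Longrightarrow> adj Y x y"
  by (auto simp: adj_def)

lemma conn_mono: "conn X x y \<Longrightarrow> X \<subseteq> Y \<Longrightarrow> conn Y x y"
  by (metis adj_mono rtranclp_mono predicate2I predicate2D)

lemma conn_in: "conn X x y \<Longrightarrow> x \<in> X \<Longrightarrow> y \<in> X"
  by (induction rule: rtranclp_induct) (auto simp: adj_def)

lemma walk_conn:
  assumes "\<forall>i<m. adj X (p i) (p (Suc i))" "i \<le> j" "j \<le> m"
  shows "conn X (p i) (p j)"
  using assms(2,3)
proof (induction j rule: dec_induct)
  case (step k)
  then show ?case using assms(1) by (meson Suc_le_lessD less_imp_le_nat rtranclp.rtrancl_into_rtrancl)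
qed simp

lemma thin_nbr:
  assumes "thin X w" "adj X w a" "adj X w b" "a \<noteq> b" "adj X w z"
  shows "z = a \<or> z = b"
  using assms unfolding thin_def by metis

lemma conn_closed:
  assumes "conn X x y" "x \<in> Z" "\<And>a b. a \<in> Z \<Longrightarrow> adj X a b \<Longrightarrow> b \<in> Z"
  shows "y \<in> Z"
  using assms(1,2) by (induction rule: rtranclp_induct) (auto intro: assms(3))

lemma conn_avoid:
  assumes "conn X x y" "\<not> conn X x w"
  shows "conn (X - {w}) x y"
  using assms(1)
proof (induction rule: rtranclp_induct)
  case (step y z)
  then have "y \<noteq> w" "z \<noteq> w"
    using assms(2) rtranclp.rtrancl_into_rtrancl[OF step(1,2)] by blast+
  then have "adj (X - {w}) y z" using step(2) by (simp add: adj_def)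
  with step(3) show ?case by (rule rtranclp.rtrancl_into_rtrancl)
qed simp

text \<open>Both claims come from shortcuts: \<open>p i\<close> is skipped if its two walk
  neighbours are adjacent, and two steps are skipped if they coincide. Inner vertices of the shorter
  walk were inner before, hence are thin, and the minimum is beaten.\<close>

lemma shortest_thin_walk:
  assumes walk: "thin_walk X p m" and "p 0 \<in> T" "p m \<in> C"
    and min: "\<And>q l. thin_walk X q l \<Longrightarrow> q 0 \<in> T \<Longrightarrow> q l \<in> C \<Longrightarrow> m \<le> l"
    and i: "0 < i" "i < m"
  shows "p (i - 1) \<noteq> p (i + 1)" "\<not> adj X (p (i - 1)) (p (i + 1))"
proof -
  have W: "\<And>j. j < m \<Longrightarrow> adj X (p j) (p (Suc j))" "\<And>j. 0 < j \<Longrightarrow> j < m \<Longrightarrow> thin X (p j)"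
    using walk by (auto simp: thin_walk_def)
  show "\<not> adj X (p (i - 1)) (p (i + 1))"
  proof
    assume a: "adj X (p (i - 1)) (p (i + 1))"
    let ?q = "\<lambda>j. if j < i then p j else p (j + 1)"
    have "adj X (?q j) (?q (Suc j))" if "j < m - 1" for j
    proof (cases "Suc j = i")
      case True
      then show ?thesis using a by auto
    next
      case False
      then show ?thesis using W(1)[of j] W(1)[of "j + 1"] that by auto
    qed
    moreover have "thin X (?q j)" if "0 < j" "j < m - 1" for j
      using W(2)[of j] W(2)[of "j + 1"] that by auto
    ultimately have "thin_walk X ?q (m - 1)"
      by (auto simp: thin_walk_def)
    moreover have "?q (m - 1) \<in> C" using i assms(3) by auto
    moreover have "?q 0 \<in> T" using i assms(2) by auto
    ultimately have "m \<le> m - 1" by (intro min)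
    then show False using i by linarith
  qed
  show "p (i - 1) \<noteq> p (i + 1)"
  proof
    assume a: "p (i - 1) = p (i + 1)"
    let ?q = "\<lambda>j. if j < i then p j else p (j + 2)"
    have "adj X (?q j) (?q (Suc j))" if "j < m - 2" for j
    proof (cases "Suc j = i")
      case True
      then show ?thesis using a W(1)[of "j + 2"] that by auto
    next
      case False
      then show ?thesis using W(1)[of j] W(1)[of "j + 2"] that by auto
    qed
    moreover have "thin X (?q j)" if "0 < j" "j < m - 2" for j
      using W(2)[of j] W(2)[of "j + 2"] that by auto
    ultimately have q: "thin_walk X ?q (m - 2)"
      by (auto simp: thin_walk_def)
    have "?q 0 \<in> T" using i assms(2) by auto
    \<comment> \<open>If the shortcut swallows the end of the walk, then
      \<open>p (i - 1) = p m\<close>, and the new walk still ends in \<open>C\<close>.\<close>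
    moreover have "?q (m - 2) \<in> C"
    proof (cases "m - 2 < i")
      case True
      then have "Suc i = m" using i by linarith
      then show ?thesis using a assms(3) i by (cases i) auto
    next
      case False
      then show ?thesis using assms(3) i by (simp add: Suc_diff_Suc numeral_2_eq_2)
    qed
    ultimately have "m \<le> m - 2" by (rule min[OF q])
    then show False using i by linarith
  qed
qed

lemma tri_in: "tri X a b c \<Longrightarrow> {a, b, c} \<subseteq> X"
  and claw_in: "claw X d x y z \<Longrightarrow> {d, x, y, z} \<subseteq> X"
  by (auto simp: tri_def claw_def adj_def)

lemma tri_conn: "tri X a b c \<Longrightarrow> s \<in> {a, b, c} \<Longrightarrow> conn X a s"
  and claw_conn: "claw X d x y z \<Longrightarrow> s \<in> {d, x, y, z} \<Longrightarrow> conn X s d"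
  by (auto simp: tri_def claw_def intro: adj_sym)

lemma goodD:
  assumes "good X" "tri X t u v" "claw X c x y z" "a \<in> {t, u, v}" "b \<in> {c, x, y, z}"
  shows "\<not> conn X a b"
proof
  assume "conn X a b"
  then have "conn X t c"
    using tri_conn[OF assms(2,4)] claw_conn[OF assms(3,5)] by (meson rtranclp_trans)
  then show False using assms(1-3) unfolding good_def by blast
qed

text \<open>An inner vertex of a shortest joining walk has degree two, so a solution that cuts the walk
  there may as well delete the end of the walk in the triangle: the freed part of the walk becomes
  a pendant path of the component of the claw, which stays triangle-free.\<close>

lemma solution_hits:
  assumes tri: "tri X t u v" and claw: "claw X c x y z"
    and walk: "thin_walk X p m" "p 0 \<in> {t, u, v}" "p m \<in> {c, x, y, z}"
    and S: "finite S" "good (X - S)"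
  shows "\<exists>w S'. w \<in> {t, u, v, c, x, y, z} \<and> w \<in> S' \<and> finite S' \<and> card S' \<le> card S \<and> good (X - S')"
proof (cases "S \<inter> {t, u, v, c, x, y, z} = {}")
  case False
  then show ?thesis using S by blast
next
  case disj: True
  define T where "T = {t, u, v}"
  define C where "C = {c, x, y, z}"
  define Y where "Y = X - S"
  have TY: "tri Y t u v" and CY: "claw Y c x y z" 
    using tri claw disj unfolding Y_def tri_def claw_def adj_def by auto
  define P where "P = (\<lambda>l. \<exists>q. thin_walk X q l \<and> q 0 \<in> T \<and> q l \<in> C)"
  have "P m" unfolding P_def T_def C_def using walk by blast
  define l where "l = (LEAST l. P l)"
  have "P l" unfolding l_def using \<open>P m\<close> by (rule LeastI)
  then obtain q where q: "thin_walk X q l" "q 0 \<in> T" "q l \<in> C" unfolding P_def by blast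
  have min: "l \<le> l'" if "thin_walk X q' l'" "q' 0 \<in> T" "q' l' \<in> C" for q' l'
    unfolding l_def by (rule Least_le) (use that in \<open>auto simp: P_def\<close>)
  have short: "q (j - 1) \<noteq> q (j + 1)" "\<not> adj X (q (j - 1)) (q (j + 1))" if "0 < j" "j < l" for j
    using shortest_thin_walk[OF q _ that] min by blast+
  have W: "\<And>j. j < l \<Longrightarrow> adj X (q j) (q (Suc j))" "\<And>j. 0 < j \<Longrightarrow> j < l \<Longrightarrow> thin X (q j)"
    using q by (auto simp: thin_walk_def)
  have nbr: "b = q (j - 1) \<or> b = q (j + 1)" if "0 < j" "j < l" "adj X (q j) b" for j b
  proof (rule thin_nbr[OF W(2) _ _ _ that(3)])
    show "adj X (q j) (q (j - 1))" using W(1)[of "j - 1"] that by (auto intro: adj_sym)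
    show "adj X (q j) (q (j + 1))" using W(1)[of j] that by auto
    show "q (j - 1) \<noteq> q (j + 1)" using short that by blast
  qed (use that in auto)
  \<comment> \<open>The other two vertices of a triangle at \<open>q j\<close> would be its two walk
    neighbours, which are not adjacent.\<close>
  have no_tri: "\<not> tri X (q j) a b" if "0 < j" "j < l" for j a b
  proof
    assume t: "tri X (q j) a b"
    then have "a \<noteq> b" "adj X a b" "adj X b a" "adj X (q j) a" "adj X (q j) b"
      unfolding tri_def by (auto simp: adj_def E_irrefl E_sym)
    then show False using nbr[OF that] short(2)[OF that] by metis
  qed
  have "\<exists>i\<le>l. q i \<in> S"
  proof (rule ccontr)
    assume "\<not> ?thesis"
    then have "\<forall>j<l. adj Y (q j) (q (Suc j))"
      using W(1) unfolding Y_def adj_def by auto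
    then have "conn Y (q 0) (q l)" by (rule walk_conn) auto
    then show False using goodD[OF _ TY CY] S q unfolding Y_def T_def C_def by blast
  qed
  then have ex: "\<exists>i. i \<le> l \<and> q i \<in> S" by blast
  \<comment> \<open>The last deleted vertex of the walk: everything after it survives and is joined
    to the claw in \<open>Y\<close>.\<close>
  define i where "i = (GREATEST i. i \<le> l \<and> q i \<in> S)"
  have i: "i \<le> l" "q i \<in> S" and i_max: "\<And>j. i < j \<Longrightarrow> j \<le> l \<Longrightarrow> q j \<notin> S"
  proof -
    show "i \<le> l" "q i \<in> S"
      using GreatestI_ex_nat[OF ex, of l] unfolding i_def by auto
    show "\<And>j. i < j \<Longrightarrow> j \<le> l \<Longrightarrow> q j \<notin> S"
      using Greatest_le_nat[of "\<lambda>i. i \<le> l \<and> q i \<in> S" _ l] unfolding i_def by (metis not_le)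
  qed
  have il: "0 < i" "i < l"
  proof -
    have "q 0 \<notin> S" "q l \<notin> S" using q disj unfolding T_def C_def by auto
    then show "0 < i" "i < l" using i by (auto intro: gr0I simp: le_less)
  qed
  define S' where "S' = insert (q 0) (S - {q i})"
  define Y' where "Y' = X - S'"
  have q0: "q 0 \<in> {t, u, v, c, x, y, z}" "q 0 \<notin> Y'" using q unfolding T_def Y'_def S'_def by auto
  have Y'Y: "Y' - {q i} \<subseteq> Y" unfolding Y_def Y'_def S'_def by auto
  have tail: "conn Y (q j) (q l)" if "i < j" "j \<le> l" for j
  proof -
    have "adj Y (q (j + k)) (q (j + Suc k))" if "j + k < l" for k
      using W(1)[of "j + k"] i_max[of "j + k"] i_max[of "Suc (j + k)"] \<open>i < j\<close> that 
      unfolding Y_def adj_def by auto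
    then have "conn Y (q (j + 0)) (q (j + (l - j)))"
      by (intro walk_conn[where p = "\<lambda>k. q (j + k)" and m = "l - j"]) auto
    then show ?thesis using that by simp
  qed
  have C': "conn Y c (q l)"
    by (rule conn_sym, rule claw_conn[OF CY]) (use q(3) C_def in blast)
  \<comment> \<open>A superset of the component of \<open>q i\<close> in \<open>Y'\<close>: the
    component of the claw in \<open>Y\<close>, extended by the freed segment of the walk, which the
    deletion of \<open>q 0\<close> cuts off from the triangle.\<close>
  define Z where "Z = {s. conn Y s (q l)} \<union> q ` {1..i}"
  have closed: "b \<in> Z" if "a \<in> Z" "adj Y' a b" for a b
  proof (cases "a \<in> q ` {1..i}")
    case True
    then obtain j where j: "a = q j" "1 \<le> j" "j \<le> i" by auto
    then have bq: "b = q (j - 1) \<or> b = q (j + 1)"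
      using nbr[of j b] il that(2) by (auto simp: Y'_def adj_def)
    have "b \<noteq> q 0" using that(2) q0 by (auto simp: adj_def)
    have "\<exists>j'. b = q j' \<and> 1 \<le> j' \<and> j' \<le> i + 1"
      using bq
    proof
      assume b: "b = q (j - 1)"
      then have "j \<noteq> 1" using \<open>b \<noteq> q 0\<close> by auto
      then show ?thesis using b j by (intro exI[of _ "j - 1"]) auto
    qed (use j in \<open>auto intro!: exI[of _ "j + 1"]\<close>)
    then obtain j' where "b = q j'" "1 \<le> j'" "j' \<le> i + 1" by blast
    then show ?thesis using tail[of "i + 1"] il unfolding Z_def
      by (cases "j' = i + 1") auto
  next
    case False
    then have a: "conn Y a (q l)" "a \<noteq> q i" using that il unfolding Z_def by auto
    show ?thesis
    proof (cases "b = q i")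
      case True
      then show ?thesis using il unfolding Z_def by auto
    next
      case False
      then have "adj Y b a" using that(2) a Y'Y by (auto simp: adj_def E_sym)
      then show ?thesis using a unfolding Z_def by (auto intro: converse_rtranclp_into_rtranclp)
    qed
  qed
  have "good Y'"
    unfolding good_def
  proof
    assume "\<exists>t u v c x y z. tri Y' t u v \<and> claw Y' c x y z \<and> conn Y' t c"
    then obtain t' u' v' c' x' y' z' where *: "tri Y' t' u' v'" "claw Y' c' x' y' z'" "conn Y' t' c'"
      by blast
    show False
    proof (cases "conn Y' t' (q i)")
      \<comment> \<open>A component of \<open>Y'\<close> that misses \<open>q i\<close> lies in
        \<open>Y\<close>, since \<open>q i\<close> is the only vertex restored.\<close>
      case False
      have tY: "conn (Y' - {q i}) t' s" if "conn Y' t' s" for s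
        using conn_avoid[OF that False] .
      have ne: "s \<noteq> q i" if "conn Y' t' s" for s using that False by auto
      have "conn Y' t' u'" "conn Y' t' v'" using tri_conn[OF *(1)] by auto
      moreover have "conn Y' t' x'" "conn Y' t' y'" "conn Y' t' z'"
        using claw_conn[OF *(2)] *(3) conn_sym by (meson insertCI rtranclp_trans)+
      ultimately have "{t', u', v', c', x', y', z'} \<subseteq> Y"
        using tri_in[OF *(1)] claw_in[OF *(2)] ne[of t'] ne[of u'] ne[of v'] ne[of c'] ne[of x'] ne[of y']
          ne[of z'] *(3) Y'Y by blast
      then have "tri Y t' u' v'" "claw Y c' x' y' z'"
        using *(1,2) unfolding tri_def claw_def adj_def by simp_all
      moreover have "conn Y t' c'" using tY[OF *(3)] Y'Y by (rule conn_mono)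
      ultimately show False using S unfolding good_def Y_def by blast
    next
      \<comment> \<open>The triangle lies in \<open>Z\<close> but avoids the segment of the walk, so
        it is joined to the original claw already in \<open>Y\<close>.\<close>
      case True
      have Zs: "s \<in> Z" if "s \<in> {t', u', v'}" for s
      proof (rule conn_closed[of Y' "q i"])
        show "conn Y' (q i) s"
          using conn_sym[OF True] tri_conn[OF *(1) that] by (rule rtranclp_trans)
        show "q i \<in> Z" using il unfolding Z_def by auto
      qed (use closed in auto)
      have "Y' \<subseteq> X" by (auto simp: Y'_def)
      then have "tri X t' u' v'"
        using *(1) unfolding tri_def adj_def by blast
      then have X: "tri X t' u' v'" "tri X u' v' t'" "tri X v' t' u'"
        unfolding tri_def using adj_sym by blast+
      have notq: "s \<notin> q ` {1..i}" if "s \<in> {t', u', v'}" for s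
        
    proof
      assume "s \<in> q ` {1..i}"
      then obtain j where "s = q j" "0 < j" "j < l" using il by auto
      then show False using X no_tri[of j] that by blast
    qed
      then have conns: "conn Y s (q l)" if "s \<in> {t', u', v'}" for s
        using Zs that unfolding Z_def by auto
      have "q i \<notin> {t', u', v'}" using notq[of "q i"] il by auto
      then have "{t', u', v'} \<subseteq> Y" using tri_in[OF *(1)] Y'Y by blast
      then have "tri Y t' u' v'" using *(1) unfolding tri_def adj_def by simp
      then show False
        using goodD[OF _ _ CY, of t' u' v' t' "q l"] conns[of t'] S(2) q(3) unfolding Y_def C_def by auto
    qed
  qed
  moreover have "card S' \<le> card S"
  proof -
    have "card S = Suc (card (S - {q i}))" using S(1) i(2) by (rule card.remove)
    then show ?thesis using card_insert_le_m1[of "card S" "S - {q i}" "q 0"] unfolding S'_def by auto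
  qed
  moreover have "finite S'" using S(1) unfolding S'_def by simp
  moreover have "q 0 \<in> S'" unfolding S'_def by simp
  ultimately show ?thesis using q0(1) unfolding Y'_def by blast
qed

text \<open>Length is minimised over all walks from triangles to claws. An inner vertex with three
  neighbours lies in a triangle if two of them are adjacent, and is the centre of a claw otherwise;
  dropping the part of the walk before it, respectively after it, would give a shorter walk.\<close>

lemma closest_pair:
  assumes "\<not> good X"
  shows "\<exists>t u v c x y z p m. tri X t u v \<and> claw X c x y z \<and> thin_walk X p m \<and> p 0 = t \<and> p m \<in> {c, x}"
proof -
  define TT where "TT = {t. \<exists>u v. tri X t u v}"
  define CC where "CC = {s. \<exists>c x y z. claw X c x y z \<and> s \<in> {c, x}}"
  define P where "P = (\<lambda>m. \<exists>p. (\<forall>i<m. adj X (p i) (p (Suc i))) \<and> p 0 \<in> TT \<and> p m \<in> CC)"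
  obtain t c where tc: "t \<in> TT" "c \<in> CC" "conn X t c"
    using assms unfolding good_def TT_def CC_def by blast
  have "\<exists>m p. (\<forall>i<m. adj X (p i) (p (Suc i))) \<and> p 0 = t \<and> p m = c"
    using tc(3)
  proof (induction rule: rtranclp_induct)
    case base
    show ?case by (rule exI[of _ 0]) auto
  next
    case (step y z)
    then obtain m p where p: "\<forall>i<m. adj X (p i) (p (Suc i))" "p 0 = t" "p m = y" by blast
    show ?case
      by (rule exI[of _ "Suc m"], rule exI[of _ "p(Suc m := z)"]) (use p step in \<open>auto simp: less_Suc_eq\<close>)
  qed
  then have "\<exists>m. P m" using tc unfolding P_def by blast
  define m where "m = (LEAST m. P m)"
  have "P m" unfolding m_def using \<open>\<exists>m. P m\<close> by (rule LeastI_ex)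
  then obtain p where p: "\<forall>i<m. adj X (p i) (p (Suc i))" "p 0 \<in> TT" "p m \<in> CC" unfolding P_def by blast
  have min: "m \<le> l" if "P l" for l unfolding m_def using that by (rule Least_le)
  have "thin X (p i)" if i: "0 < i" "i < m" for i
  proof (rule ccontr)
    assume "\<not> thin X (p i)"
    moreover have "p i \<in> X" using p i by (auto simp: adj_def)
    ultimately obtain a b d where *: "adj X (p i) a" "adj X (p i) b" "adj X (p i) d" "a \<noteq> b" "b \<noteq> d" "a \<noteq> d"
      unfolding thin_def by blast
    have TT: "p i \<notin> TT"
    proof
      assume "p i \<in> TT"
      then have "P (m - i)"
        unfolding P_def using p i by (intro exI[of _ "\<lambda>k. p (i + k)"]) auto
      then show False using min i by fastforce
    qed
    have CC: "p i \<notin> CC"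
    proof
      assume "p i \<in> CC"
      then have "P i"
        unfolding P_def using p i by (intro exI[of _ p]) auto
      then show False using min i by fastforce
    qed
    show False
    proof (cases "E a b \<or> E b d \<or> E a d")
      case True
      then have "p i \<in> TT" using * unfolding TT_def tri_def adj_def by blast
      then show ?thesis using TT by simp
    next
      case False
      then have "claw X (p i) a b d" using * unfolding claw_def by blast
      then show ?thesis using CC unfolding CC_def by blast
    qed
  qed
  then have "thin_walk X p m" using p unfolding thin_walk_def by blast
  then show ?thesis using p(2,3) unfolding TT_def CC_def by blast
qed

text \<open>\<open>S\<close> may leave \<open>X\<close>, so solutions pass between \<open>X\<close>
  and \<open>X - {w}\<close> without restriction. Finiteness is demanded because infinite sets have
  \<open>card\<close> 0.\<close>

definition solvable :: "nat \<Rightarrow> 'a set \<Rightarrow> bool" where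
  "solvable b X \<longleftrightarrow> (\<exists>S. finite S \<and> card S \<le> b \<and> good (X - S))"

lemma solvable_good: "good X \<Longrightarrow> solvable b X"
  unfolding solvable_def by (intro exI[of _ "{}"]) auto

lemma solvable_branch:
  assumes "tri X t u v" "claw X c x y z"
    and "thin_walk X p m" "p 0 \<in> {t, u, v}" "p m \<in> {c, x, y, z}"
  shows "solvable b X \<longleftrightarrow> (\<exists>w \<in> {t, u, v, c, x, y, z}. 0 < b \<and> solvable (b - 1) (X - {w}))"
proof
  assume "solvable b X"
  then obtain S where S: "finite S" "card S \<le> b" "good (X - S)" unfolding solvable_def by blast
  then obtain w S' where *: "w \<in> {t, u, v, c, x, y, z}" "w \<in> S'" "finite S'" "card S' \<le> b" "good (X - S')"
    using solution_hits[OF assms S(1,3)] by (metis order_trans)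
  then have "0 < card S'" by (metis card_gt_0_iff empty_iff)
  then have "0 < b" using * by linarith
  moreover have "solvable (b - 1) (X - {w})"
    unfolding solvable_def
  proof (intro exI conjI)
    show "finite (S' - {w})" "card (S' - {w}) \<le> b - 1" using * by auto
    have "X - {w} - (S' - {w}) = X - S'" using * by auto
    then show "good (X - {w} - (S' - {w}))" using * by simp
  qed
  ultimately show "\<exists>w \<in> {t, u, v, c, x, y, z}. 0 < b \<and> solvable (b - 1) (X - {w})" using * by blast
next
  assume "\<exists>w \<in> {t, u, v, c, x, y, z}. 0 < b \<and> solvable (b - 1) (X - {w})"
  then obtain w S where S: "0 < b" "finite S" "card S \<le> b - 1" and g: "good (X - {w} - S)"
    unfolding solvable_def by blast
  have "card (insert w S) \<le> b" using S card_insert_le_m1[of b S w] by simp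
  moreover have "good (X - insert w S)" by (subst Diff_insert2) (rule g)
  ultimately show "solvable b X"
    unfolding solvable_def using S(2) by (intro exI[of _ "insert w S"]) simp
qed

end

section \<open>Reachability through thin vertices\<close>

fun warshall :: "(nat \<Rightarrow> nat \<Rightarrow> bool) \<Rightarrow> (nat \<Rightarrow> bool) \<Rightarrow> nat \<Rightarrow> nat \<Rightarrow> nat \<Rightarrow> bool" where
  "warshall R D 0 = R"
| "warshall R D (Suc w) = (\<lambda>x y. warshall R D w x y \<or> D w \<and> warshall R D w x w \<and> warshall R D w w y)"

lemma warshall_mono: "R x y \<Longrightarrow> warshall R D m x y"
  by (induction m) auto

text \<open>Completeness of the algorithm without decomposing paths: after \<open>m\<close> rounds
  the relation composes at every admissible \<open>w < m\<close>. In the induction step each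
  hypothesis is old or passes through \<open>m\<close>; gluing old parts at \<open>w\<close> gives a
  pair that is again old or passes through \<open>m\<close>.\<close>

lemma warshall_trans:
  "w < m \<Longrightarrow> D w \<Longrightarrow> warshall R D m x w \<Longrightarrow> warshall R D m w y \<Longrightarrow> warshall R D m x y"
proof (induction m arbitrary: x y)
  case (Suc m)
  show ?case
  proof (cases "w = m")
    case True
    then show ?thesis using Suc.prems by auto
  next
    case False
    then have "w < m" using Suc.prems(1) by simp
    note IH = Suc.IH[OF this Suc.prems(2)]
    show ?thesis using Suc.prems(3,4) IH unfolding warshall.simps by blast
  qed
qed simp

context sym_irrefl
begin

lemma thin_walk_append:
  assumes "thin_walk X p l" "thin_walk X q k" "p l = q 0" "thin X (q 0)"
  shows "thin_walk X (\<lambda>i. if i < l then p i else q (i - l)) (l + k)"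
proof -
  let ?r = "\<lambda>i. if i < l then p i else q (i - l)"
  have "adj X (?r i) (?r (Suc i))" if "i < l + k" for i
  proof -
    consider "Suc i < l" | "Suc i = l" | "l \<le> i" by linarith
    then show ?thesis
    proof cases
      case 2
      then show ?thesis using assms(1,3) unfolding thin_walk_def by (metis lessI nat_neq_iff diff_self_eq_0)
    next
      case 3
      then show ?thesis using assms(2) that unfolding thin_walk_def by (simp add: Suc_diff_le)
    qed (use assms(1) in \<open>simp add: thin_walk_def\<close>)
  qed
  moreover have "thin X (?r i)" if "0 < i" "i < l + k" for i
  proof -
    consider "i < l" | "i = l" | "l < i" by linarith
    then show ?thesis
      using assms that unfolding thin_walk_def by cases auto
  qed
  ultimately show ?thesis unfolding thin_walk_def by blast
qed

end

locale sym_irrefl_nat = sym_irrefl E for E :: "nat \<Rightarrow> nat \<Rightarrow> bool"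
begin

text \<open>Only inner vertices have to be thin, so \<open>thin\<close> filters the intermediate
  points and not the base relation. Reflexivity stands for walks of length 0, which occur when the
  triangle and the claw share a vertex.\<close>

definition thin_reach :: "nat \<Rightarrow> nat set \<Rightarrow> nat \<Rightarrow> nat \<Rightarrow> bool" where
  "thin_reach m X = warshall (\<lambda>x y. x \<in> X \<and> y \<in> X \<and> (x = y \<or> E x y)) (thin X) m"

lemma thin_reach_walk:
  "thin_reach m X x y \<Longrightarrow> x \<in> X \<and> (\<exists>p l. thin_walk X p l \<and> p 0 = x \<and> p l = y)"
  unfolding thin_reach_def
proof (induction m arbitrary: x y)
  case 0
  show ?case
  proof (cases "x = y")
    case True
    then show ?thesis using 0 by (auto simp: thin_walk_def intro!: exI[of _ "\<lambda>_. y"] exI[of _ "0::nat"])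
  next
    case False
    then have "adj X x y" using 0 by (simp add: adj_def)
    then show ?thesis using 0
      by (auto simp: thin_walk_def intro!: exI[of _ "\<lambda>i. if i = 0 then x else y"] exI[of _ "Suc 0"])
  qed
next
  case (Suc m)
  let ?W = "warshall (\<lambda>x y. x \<in> X \<and> y \<in> X \<and> (x = y \<or> E x y)) (thin X)"
  show ?case
  proof (cases "?W m x y")
    case True
    then show ?thesis by (rule Suc.IH)
  next
    case False
    then have *: "thin X m" "?W m x m" "?W m m y" using Suc.prems by auto
    obtain p l where p: "thin_walk X p l" "p 0 = x" "p l = m" using Suc.IH[OF *(2)] by blast
    obtain q k where q: "thin_walk X q k" "q 0 = m" "q k = y" using Suc.IH[OF *(3)] by blast
    let ?r = "\<lambda>i. if i < l then p i else q (i - l)"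
    have "thin_walk X ?r (l + k)" by (rule thin_walk_append) (use p q * in auto)
    moreover have "?r 0 = x" "?r (l + k) = y" using p q by auto
    moreover have "x \<in> X" using Suc.IH[OF *(2)] by blast
    ultimately show ?thesis by blast
  qed
qed

lemma thin_walk_reach:
  assumes "X \<subseteq> {..<n}" "thin_walk X p l" "p 0 \<in> X"
  shows "thin_reach n X (p 0) (p l)"
  using assms(2)
proof (induction l)
  case 0
  then show ?case using assms(3) by (auto simp: thin_reach_def intro!: warshall_mono)
next
  case (Suc l)
  then have *: "adj X (p l) (p (Suc l))" and "thin_walk X p l" by (auto simp: thin_walk_def)
  then have r: "thin_reach n X (p 0) (p l)" by (intro Suc.IH)
  have e: "thin_reach n X (p l) (p (Suc l))"
    using * by (auto simp: thin_reach_def adj_def intro!: warshall_mono)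
  show ?case
  \<comment> \<open>The start of the walk need not be thin, so composition at \<open>p l\<close> is
    available only for \<open>l > 0\<close>.\<close>
  proof (cases "l = 0")
    case True
    then show ?thesis using e by simp
  next
    case False
    then have "thin X (p l)" using Suc.prems by (auto simp: thin_walk_def)
    moreover have "p l < n" using assms(1) * by (auto simp: adj_def)
    ultimately show ?thesis using r e unfolding thin_reach_def by (meson warshall_trans)
  qed
qed

text \<open>The walk is tested only from \<open>t\<close> to \<open>c\<close> or \<open>x\<close>:
  as all labellings are searched, \<open>t\<close> can be any vertex of the triangle and
  \<open>x\<close> any leaf of the claw.\<close>

definition bad_pair :: "nat \<Rightarrow> nat set \<Rightarrow> nat \<Rightarrow> nat \<Rightarrow> nat \<Rightarrow> nat \<Rightarrow> nat \<Rightarrow> nat \<Rightarrow> nat \<Rightarrow> bool" where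
  "bad_pair n X t u v c x y z \<longleftrightarrow>
     tri X t u v \<and> claw X c x y z \<and> (thin_reach n X t c \<or> thin_reach n X t x)"

lemma bad_pair_exists:
  assumes "X \<subseteq> {..<n}" "\<not> good X"
  shows "\<exists>t u v c x y z. bad_pair n X t u v c x y z"
proof -
  obtain t u v c x y z p m where *: "tri X t u v" "claw X c x y z" "thin_walk X p m" "p 0 = t" "p m \<in> {c, x}"
    using closest_pair[OF assms(2)] by blast
  then have "thin_reach n X (p 0) (p m)"
    using tri_in by (intro thin_walk_reach[OF assms(1)]) auto
  then show ?thesis using * unfolding bad_pair_def by blast
qed

lemma bad_pair_branch:
  assumes "bad_pair n X t u v c x y z"
  shows "solvable b X \<longleftrightarrow> (\<exists>w \<in> {t, u, v, c, x, y, z}. 0 < b \<and> solvable (b - 1) (X - {w}))"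
proof -
  obtain p m where "thin_walk X p m" "p 0 = t" "p m \<in> {c, x}"
    using assms thin_reach_walk unfolding bad_pair_def by (metis insertCI)
  then show ?thesis
    using assms by (intro solvable_branch[of _ _ _ _ _ _ _ _ p m]) (auto simp: bad_pair_def)
qed

end

section \<open>Deletion sets of pair graphs\<close>

context pair_graph
begin

abbreviation edge :: "'a \<Rightarrow> 'a \<Rightarrow> bool" where
  "edge x y \<equiv> (x, y) \<in> parcs G"

lemma sym_irrefl_edge: "sym_irrefl edge"
proof
  show "edge x y \<Longrightarrow> edge y x" for x y using graph_symmetric by simp
  show "\<not> edge x x" for x using pair_no_loops by fastforce
qed

interpretation sym_irrefl edge by (rule sym_irrefl_edge)

lemma induced_pairs:
  assumes "U \<subseteq> pverts G" "W \<subseteq> U"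
  shows "induced_subgraph (with_proj \<lparr>pverts = W, parcs = {e \<in> parcs G. fst e \<in> W \<and> snd e \<in> W}\<rparr>) (with_proj G \<restriction> U)"
  using assms
  by (auto simp: induced_subgraph_def subgraph_def compatible_def wf_digraph_def induce_subgraph_def)

lemma induced_arcs_ends:
  assumes "induced_subgraph H (with_proj G \<restriction> U)"
  shows "(x, y) \<in> arcs_ends H \<longleftrightarrow> x \<in> verts H \<and> y \<in> verts H \<and> edge x y" "verts H \<subseteq> U"
  using assms
  by (auto simp: induced_subgraph_def subgraph_def compatible_def arcs_ends_def arc_to_ends_def
     induce_subgraph_def wf_digraph_def image_iff)

lemma triangle_free_iff:
  assumes U: "U \<subseteq> pverts G"
  shows "triangle_free (with_proj G \<restriction> U) \<longleftrightarrow> \<not> (\<exists>a b c. tri U a b c)"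
proof -
  have "\<exists>a b c. tri U a b c" if H: "induced_subgraph H (with_proj G \<restriction> U)" "K\<^bsub>3\<^esub> H" for H
  proof -
    obtain a b c where abc: "verts H = {a, b, c}" "a \<noteq> b" "b \<noteq> c" "a \<noteq> c"
      using H(2) unfolding complete_digraph_def card_3_iff by blast
    have "(a, b) \<in> arcs_ends H" "(b, c) \<in> arcs_ends H" "(a, c) \<in> arcs_ends H"
      using H(2) abc unfolding complete_digraph_def by auto
    then show ?thesis
      using induced_arcs_ends[OF H(1)] unfolding tri_def adj_def by blast
  qed
  moreover have "\<exists>H. induced_subgraph H (with_proj G \<restriction> U) \<and> K\<^bsub>3\<^esub> H" if t: "tri U a b c" for a b c
  proof -
    let ?W = "{a, b, c}"
    let ?H = "\<lparr>pverts = ?W, parcs = {e \<in> parcs G. fst e \<in> ?W \<and> snd e \<in> ?W}\<rparr>"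
    have e: "edge a b" "edge b c" "edge a c" using t unfolding tri_def adj_def by simp_all
    then have e': "edge b a" "edge c b" "edge c a" by (simp_all add: E_sym)
    have d: "a \<noteq> b" "b \<noteq> c" "a \<noteq> c" using e E_irrefl by metis+
    have "\<forall>p \<in> ?W. \<forall>q \<in> ?W. edge p q \<longleftrightarrow> p \<noteq> q"
      using d e e' E_irrefl by simp
    then have "parcs ?H = {(p, q). (p, q) \<in> ?W \<times> ?W \<and> p \<noteq> q}"
      unfolding pair_pre_digraph.simps by (intro set_eqI) (clarsimp simp only: mem_Collect_eq split_paired_all fst_conv snd_conv case_prod_conv mem_Times_iff, blast)
    then have "K\<^bsub>3\<^esub> (with_proj ?H)"
      unfolding complete_digraph_pair_def using d by simp
    moreover have "induced_subgraph (with_proj ?H) (with_proj G \<restriction> U)"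
      using tri_in[OF t] by (intro induced_pairs U)
    ultimately show ?thesis by blast
  qed
  ultimately show ?thesis unfolding triangle_free_def by blast
qed

lemma claw_free_iff:
  assumes U: "U \<subseteq> pverts G"
  shows "claw_free (with_proj G \<restriction> U) \<longleftrightarrow> \<not> (\<exists>c x y z. claw U c x y z)"
proof -
  have "\<exists>c x y z. claw U c x y z" if H: "induced_subgraph H (with_proj G \<restriction> U)" "K\<^bsub>1,3\<^esub> H" for H
  proof -
    obtain A B where AB: "verts H = A \<union> B" "A \<inter> B = {}" "card A = 1" "card B = 3"
        "arcs_ends H = A \<times> B \<union> B \<times> A"
      using H(2) unfolding complete_bipartite_digraph_def by blast
    obtain c where c: "A = {c}" using AB(3) by (auto simp: card_1_singleton_iff)
    obtain x y z where xyz: "B = {x, y, z}" "x \<noteq> y" "y \<noteq> z" "x \<noteq> z"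
      using AB(4) unfolding card_3_iff by blast
    have "(c, x) \<in> arcs_ends H" "(c, y) \<in> arcs_ends H" "(c, z) \<in> arcs_ends H"
        "(x, y) \<notin> arcs_ends H" "(y, z) \<notin> arcs_ends H" "(x, z) \<notin> arcs_ends H"
      using AB xyz c by auto
    then have e: "edge c x" "edge c y" "edge c z" "\<not> edge x y" "\<not> edge y z" "\<not> edge x z"
      unfolding induced_arcs_ends(1)[OF H(1)] AB(1) c xyz(1) by simp_all
    have "c \<in> U" "x \<in> U" "y \<in> U" "z \<in> U"
      using induced_arcs_ends(2)[OF H(1)] unfolding AB(1) c xyz(1) by simp_all
    then have "claw U c x y z" using e xyz unfolding claw_def adj_def by simp
    then show ?thesis by blast
  qed
  moreover have "\<exists>H. induced_subgraph H (with_proj G \<restriction> U) \<and> K\<^bsub>1,3\<^esub> H" if t: "claw U c x y z" for c x y z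
  proof -
    let ?W = "{c, x, y, z}"
    let ?H = "\<lparr>pverts = ?W, parcs = {e \<in> parcs G. fst e \<in> ?W \<and> snd e \<in> ?W}\<rparr>"
    have e: "edge c x" "edge c y" "edge c z" "\<not> edge x y" "\<not> edge y z" "\<not> edge x z"
      and d: "x \<noteq> y" "y \<noteq> z" "x \<noteq> z"
      using t unfolding claw_def adj_def by simp_all
    have e': "edge x c" "edge y c" "edge z c" using e by (simp_all add: E_sym)
    have "\<not> edge y x" "\<not> edge z y" "\<not> edge z x" using e E_sym by metis+
    note e = e e' this
    have d': "c \<noteq> x" "c \<noteq> y" "c \<noteq> z" using e E_irrefl by metis+
    have "\<forall>p \<in> ?W. \<forall>q \<in> ?W. edge p q \<longleftrightarrow> p = c \<and> q \<in> {x, y, z} \<or> p \<in> {x, y, z} \<and> q = c"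
      using d d' e E_irrefl by simp
    then have "parcs ?H = {c} \<times> {x, y, z} \<union> {x, y, z} \<times> {c}"
      unfolding pair_pre_digraph.simps by (intro set_eqI) (clarsimp simp only: mem_Collect_eq split_paired_all fst_conv snd_conv Un_iff mem_Times_iff, blast)
    moreover have "pverts ?H = {c} \<union> {x, y, z}" unfolding pair_pre_digraph.simps by (rule insert_is_Un)
    moreover have "{c} \<inter> {x, y, z} = {}" "card {x, y, z} = 3" using d d' by simp_all
    moreover have "finite (pverts ?H)" "card {c} = 1" by simp_all
    ultimately have "K\<^bsub>1,3\<^esub> (with_proj ?H)"
      unfolding complete_bipartite_digraph_pair_def by blast
    moreover have "induced_subgraph (with_proj ?H) (with_proj G \<restriction> U)"
      using claw_in[OF t] by (intro induced_pairs U)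
    ultimately show ?thesis by blast
  qed
  ultimately show ?thesis unfolding claw_free_def by blast
qed

section \<open>Components of the remaining graph\<close>

lemma reachable_iff_conn:
  assumes "X \<subseteq> pverts G"
  shows "u \<rightarrow>\<^sup>*\<^bsub>with_proj G \<restriction> X\<^esub> v \<longleftrightarrow> u \<in> X \<and> conn X u v"
proof -
  have ends: "(a, b) \<in> arcs_ends (with_proj G \<restriction> X) \<longleftrightarrow> adj X a b" for a b
    by (auto simp: adj_def arcs_ends_def arc_to_ends_def induce_subgraph_def image_iff)
  show ?thesis
  proof
    assume "u \<rightarrow>\<^sup>*\<^bsub>with_proj G \<restriction> X\<^esub> v"
    then have "(u, v) \<in> rtrancl_on X (arcs_ends (with_proj G \<restriction> X))"
      by (simp add: reachable_def)
    then show "u \<in> X \<and> conn X u v"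
      by (induction rule: rtrancl_on_induct)
        (auto simp: ends[unfolded induce_subgraph_def] ends intro: rtranclp.rtrancl_into_rtrancl)
  next
    assume "u \<in> X \<and> conn X u v"
    then have "u \<in> X" "conn X u v" by auto
    from this(2,1) have "(u, v) \<in> rtrancl_on X (arcs_ends (with_proj G \<restriction> X))"
    proof (induction rule: rtranclp_induct)
      case (step y z)
      then show ?case using ends[of y z] by (auto simp: adj_def intro: rtrancl_on_into_rtrancl_on)
    qed simp
    then show "u \<rightarrow>\<^sup>*\<^bsub>with_proj G \<restriction> X\<^esub> v" by (simp add: reachable_def)
  qed
qed

text \<open>The components are the classes of \<open>conn\<close>. A triangle or a claw in
  \<open>X\<close> is connected, so it lies inside one class, and some class contains both kinds
  exactly when \<open>conn\<close> joins one of each.\<close>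

lemma deletion_set_iff:
  "claw_or_triangle_free_deletion_set (with_proj G) S \<longleftrightarrow> S \<subseteq> pverts G \<and> good (pverts G - S)"
proof -
  define X where "X = pverts G - S"
  have X: "X \<subseteq> pverts G" unfolding X_def by blast
  interpret GX: wf_digraph "with_proj G \<restriction> X"
    using X by (auto simp: wf_digraph_def induce_subgraph_def)
  have sub: "(with_proj G \<restriction> X) \<restriction> U = with_proj G \<restriction> U" if "U \<subseteq> X" for U
    using that by (auto simp: induce_subgraph_def)
  have verts_in: "U \<subseteq> X" "\<And>s t. s \<in> U \<Longrightarrow> t \<in> U \<Longrightarrow> conn X s t" if "U \<in> GX.sccs_verts" for U
    using that unfolding GX.sccs_verts_def reachable_iff_conn[OF X] by blast+
  have class_in: "{s. conn X t s} \<in> GX.sccs_verts" if "t \<in> X" for t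
    unfolding GX.sccs_verts_def reachable_iff_conn[OF X]
    using that conn_in[of X t] conn_sym[of X] by (auto intro: rtranclp_trans)
  have "(\<forall>H \<in> pre_digraph.sccs (with_proj G \<restriction> X). claw_free H \<or> triangle_free H) \<longleftrightarrow>
      (\<forall>U \<in> GX.sccs_verts. \<not> (\<exists>c x y z. claw U c x y z) \<or> \<not> (\<exists>a b c. tri U a b c))"
    unfolding GX.sccs_conv_sccs_verts ball_simps
  proof (rule ball_cong[OF refl])
    fix U assume "U \<in> GX.sccs_verts"
    then have "U \<subseteq> X" "U \<subseteq> pverts G" using verts_in(1) X by blast+
    then show "claw_free ((with_proj G \<restriction> X) \<restriction> U) \<or> triangle_free ((with_proj G \<restriction> X) \<restriction> U) \<longleftrightarrow>
        \<not> (\<exists>c x y z. claw U c x y z) \<or> \<not> (\<exists>a b c. tri U a b c)"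
      using sub claw_free_iff triangle_free_iff by simp
  qed
  also have "\<dots> \<longleftrightarrow> good X"
  proof
    assume L: "\<forall>U \<in> GX.sccs_verts. \<not> (\<exists>c x y z. claw U c x y z) \<or> \<not> (\<exists>a b c. tri U a b c)"
    show "good X"
      unfolding good_def
    proof
      assume "\<exists>t u v c x y z. tri X t u v \<and> claw X c x y z \<and> conn X t c"
      then obtain t u v c x y z where *: "tri X t u v" "claw X c x y z" "conn X t c" by blast
      let ?U = "{s. conn X t s}"
      have "{t, u, v} \<subseteq> ?U" using tri_conn[OF *(1)] by blast
      then have "tri ?U t u v" using *(1) by (simp add: tri_def adj_def)
      moreover have "{c, x, y, z} \<subseteq> ?U"
        using claw_conn[OF *(2)] *(3) conn_sym rtranclp_trans[of "adj X" t c] by blast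
      then have "claw ?U c x y z" using *(2) by (simp add: claw_def adj_def)
      moreover have "?U \<in> GX.sccs_verts" using tri_in[OF *(1)] by (intro class_in) auto
      ultimately show False using L by blast
    qed
  next
    assume g: "good X"
    show "\<forall>U \<in> GX.sccs_verts. \<not> (\<exists>c x y z. claw U c x y z) \<or> \<not> (\<exists>a b c. tri U a b c)"
    proof (intro ballI, rule ccontr)
      fix U assume U: "U \<in> GX.sccs_verts"
      assume "\<not> (\<not> (\<exists>c x y z. claw U c x y z) \<or> \<not> (\<exists>a b c. tri U a b c))"
      then obtain t u v c x y z where *: "tri U t u v" "claw U c x y z" by blast
      then have "t \<in> U" "c \<in> U" using tri_in claw_in by auto
      then have "conn X t c" using verts_in[OF U] by blast
      moreover have "tri X t u v" "claw X c x y z"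
        using * verts_in(1)[OF U] unfolding tri_def claw_def adj_def by auto
      ultimately show False using g unfolding good_def by blast
    qed
  qed
  finally show ?thesis
    unfolding claw_or_triangle_free_deletion_set_def X_def by simp
qed

lemma deletion_iff_solvable:
  "(\<exists>S. claw_or_triangle_free_deletion_set (with_proj G) S \<and> card S \<le> k) \<longleftrightarrow> solvable k (pverts G)"
proof
  assume "\<exists>S. claw_or_triangle_free_deletion_set (with_proj G) S \<and> card S \<le> k"
  then show "solvable k (pverts G)"
    unfolding deletion_set_iff solvable_def using pair_finite_verts finite_subset by blast
next
  assume "solvable k (pverts G)"
  then obtain S where S: "finite S" "card S \<le> k" "good (pverts G - S)" unfolding solvable_def by blast
  have "pverts G - S \<inter> pverts G = pverts G - S" by blast
  moreover have "card (S \<inter> pverts G) \<le> k" using S card_mono[of S "S \<inter> pverts G"] by simp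
  ultimately show "\<exists>S. claw_or_triangle_free_deletion_set (with_proj G) S \<and> card S \<le> k"
    unfolding deletion_set_iff using S by (intro exI[of _ "S \<inter> pverts G"]) simp
qed

end

section \<open>Total correctness with polynomial time bounds\<close>

abbreviation Var :: "string \<Rightarrow> expr" where
  "Var x \<equiv> Load x (Const 0)"

abbreviation set_var :: "store \<Rightarrow> string \<Rightarrow> nat \<Rightarrow> store" where
  "set_var s x v \<equiv> s(x := (s x)(0 := v))"

text \<open>Large enough for the addresses of a stack of at most \<open>2 \<cdot> 7\<^sup>n\<close> frames of \<open>n\<close> cells.\<close>

definition cap :: "nat \<Rightarrow> nat" where
  "cap n = 16 ^ (n + 2)"

text \<open>Invariant of all runs: it makes every operation polynomial, since the binary length of
  \<open>cap n\<close> is linear in \<open>n\<close>, and it freezes the register \<open>n\<close>,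
  on which all loop limits depend.\<close>

definition ok :: "nat \<Rightarrow> store \<Rightarrow> bool" where
  "ok n s \<longleftrightarrow> (\<forall>a i. s a i \<le> cap n) \<and> s ''n'' 0 = n"

text \<open>Bits by which a value may exceed a cell bounded by \<open>cap n\<close>; an addition
  contributes one. A constant is crudely given \<open>v\<close> bits, as
  \<open>v \<le> 2 ^ v\<close>.\<close>

primrec expr_size :: "expr \<Rightarrow> nat" where
  "expr_size (Const v) = v"
| "expr_size (Load a e) = 0"
| "expr_size (Add e1 e2) = Suc (expr_size e1 + expr_size e2)"
| "expr_size (Sub e1 e2) = expr_size e1"

text \<open>Exponents are propagated instead of polynomials: the base \<open>n + 2\<close> is at
  least 2, so a sum of two powers is absorbed by adding the exponents and 1.\<close>

primrec expr_deg :: "expr \<Rightarrow> nat" where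
  "expr_deg (Const v) = v + 4"
| "expr_deg (Load a e) = expr_deg e + 5"
| "expr_deg (Add e1 e2) = expr_deg e1 + expr_deg e2 + expr_size (Add e1 e2) + 6"
| "expr_deg (Sub e1 e2) = expr_deg e1 + expr_deg e2 + expr_size e1 + 6"

text \<open>The clause for \<open>WhileNZ\<close> presupposes at most \<open>n\<close> rounds, an
  obligation imposed by \<open>runs_While\<close>: of the summand 3, 2 is for adding up one round
  and 1 for the factor \<open>n + 2\<close>.\<close>

primrec prog_deg :: "prog \<Rightarrow> nat" where
  "prog_deg Skip = 0"
| "prog_deg (Store a e1 e2) = expr_deg e1 + expr_deg e2 + 2"
| "prog_deg (Seq p q) = prog_deg p + prog_deg q + 1"
| "prog_deg (IfNZ e p q) = expr_deg e + prog_deg p + prog_deg q + 2"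
| "prog_deg (WhileNZ e p) = expr_deg e + prog_deg p + 3"

primrec writes :: "prog \<Rightarrow> string set" where
  "writes Skip = {}"
| "writes (Store a e1 e2) = {a}"
| "writes (Seq p q) = writes p \<union> writes q"
| "writes (IfNZ e p q) = writes p \<union> writes q"
| "writes (WhileNZ e p) = writes p"

lemma exec_writes: "exec p s t s' \<Longrightarrow> a \<notin> writes p \<Longrightarrow> s' a = s a"
  by (induction rule: exec.induct) auto

lemma cap_eq: "cap n = 2 ^ (4 * (n + 2))"
  unfolding cap_def by (subst power_mult) simp

lemma val_le: "ok n s \<Longrightarrow> val e s \<le> 2 ^ (4 * (n + 2) + expr_size e)"
proof (induction e)
  case (Const v)
  have "v \<le> 2 ^ v" by (rule less_imp_le) simp
  also have "\<dots> \<le> 2 ^ (4 * (n + 2) + v)" by (rule power_increasing) auto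
  finally show ?case by simp
next
  case (Load a e)
  then show ?case by (simp add: ok_def cap_eq)
next
  case (Add e1 e2)
  have "val e1 s \<le> 2 ^ (4 * (n + 2) + (expr_size e1 + expr_size e2))"
    using Add by (meson order_trans power_increasing one_le_numeral add_le_mono le_add1 order_refl)
  moreover have "val e2 s \<le> 2 ^ (4 * (n + 2) + (expr_size e1 + expr_size e2))"
    using Add by (meson order_trans power_increasing one_le_numeral add_le_mono le_add2 order_refl)
  moreover have "4 * (n + 2) + expr_size (Add e1 e2) = Suc (4 * (n + 2) + (expr_size e1 + expr_size e2))"
    by simp
  ultimately show ?case unfolding val.simps by (simp only: power_Suc)
next
  case (Sub e1 e2)
  then show ?case by (simp add: le_diff_conv trans_le_add1)
qed

lemma pow_add_le: "(N::nat) ^ a + N ^ b \<le> N ^ (a + b + 1)" if "2 \<le> N"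
proof -
  have "N ^ a \<le> N ^ (a + b)" "N ^ b \<le> N ^ (a + b)"
    using that by (auto intro!: power_increasing)
  then have "N ^ a + N ^ b \<le> 2 * N ^ (a + b)" by simp
  also have "\<dots> \<le> N * N ^ (a + b)" using that by (rule mult_le_mono1)
  finally show ?thesis by simp
qed

lemma pow_add3_le: "(N::nat) ^ a + N ^ b + N ^ c \<le> N ^ (a + b + c + 2)" if "2 \<le> N"
  using pow_add_le[OF that, of a b] pow_add_le[OF that, of "a + b + 1" c] by (simp add: ac_simps)

text \<open>The cost is at most \<open>4 * (n + 2) + z + 2\<close>, hence at most
  \<open>(n + 2) * 2 ^ (z + 3)\<close>, and the power of two is absorbed by
  \<open>(n + 2) ^ (z + 3)\<close>.\<close>

lemma log_cost_le: "v \<le> 2 ^ (4 * (n + 2) + z) \<Longrightarrow> log_cost v \<le> (n + 2) ^ (z + 4)"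
proof -
  assume "v \<le> 2 ^ (4 * (n + 2) + z)"
  then have "v < 2 ^ (4 * (n + 2) + z + 1)" by (simp add: less_le_trans le_less_trans)
  then have "log_cost v \<le> 4 * (n + 2) + z + 2"
    unfolding log_cost_def using floorlog_leI[of v 2 "4 * (n + 2) + z + 1"] by simp
  also have "\<dots> \<le> 8 * (n + 2) * 2 ^ z"
  proof -
    have "z + 1 \<le> 2 ^ z" by (induction z) auto
    then have "(n + 2) * (z + 1) \<le> (n + 2) * 2 ^ z" by (rule mult_le_mono2)
    then show ?thesis by (simp add: algebra_simps)
  qed
  also have "\<dots> \<le> (n + 2) ^ (z + 4)"
  proof -
    have "(2::nat) ^ (z + 3) \<le> (n + 2) ^ (z + 3)" by (rule power_mono) auto
    then have "(n + 2) * 2 ^ (z + 3) \<le> (n + 2) * (n + 2) ^ (z + 3)" by (rule mult_le_mono2)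
    moreover have "(n + 2) * (n + 2) ^ (z + 3) = (n + 2) ^ (z + 4)"
      by (subst power_Suc[symmetric]) (simp only: add_Suc_right[symmetric] numeral_eq_Suc pred_numeral_simps arith_simps)
    moreover have "8 * (n + 2) * 2 ^ z = (n + 2) * (2::nat) ^ (z + 3)"
      by (simp add: power_add algebra_simps)
    ultimately show ?thesis by linarith
  qed
  finally show ?thesis .
qed

lemma expr_cost_le: "ok n s \<Longrightarrow> expr_cost e s \<le> (n + 2) ^ expr_deg e"
proof (induction e)
  case (Const v)
  have "v \<le> 2 ^ (4 * (n + 2) + v)" using val_le[OF Const, of "Const v"] by simp
  then show ?case using log_cost_le by simp
next
  case (Load a e)
  have "log_cost (s a (val e s)) \<le> (n + 2) ^ (0 + 4)"
    by (rule log_cost_le) (use val_le[OF Load.prems, of "Load a e"] in simp)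
  then have "expr_cost (Load a e) s \<le> (n + 2) ^ expr_deg e + (n + 2) ^ 4"
    using Load by simp
  also have "\<dots> \<le> (n + 2) ^ (expr_deg e + 4 + 1)" by (rule pow_add_le) simp
  also have "expr_deg e + 4 + 1 = expr_deg (Load a e)" by simp
  finally show ?case .
next
  case (Add e1 e2)
  have "log_cost (val e1 s + val e2 s) \<le> (n + 2) ^ (expr_size (Add e1 e2) + 4)"
    by (rule log_cost_le) (use val_le[OF Add.prems, of "Add e1 e2"] in simp)
  then have "expr_cost (Add e1 e2) s \<le>
      (n + 2) ^ expr_deg e1 + (n + 2) ^ expr_deg e2 + (n + 2) ^ (expr_size (Add e1 e2) + 4)"
    using Add by (simp del: expr_size.simps)
  also have "\<dots> \<le> (n + 2) ^ (expr_deg e1 + expr_deg e2 + (expr_size (Add e1 e2) + 4) + 2)"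
    by (rule pow_add3_le) simp
  also have "expr_deg e1 + expr_deg e2 + (expr_size (Add e1 e2) + 4) + 2 = expr_deg (Add e1 e2)" by simp
  finally show ?case .
next
  case (Sub e1 e2)
  have "log_cost (val e1 s - val e2 s) \<le> (n + 2) ^ (expr_size (Sub e1 e2) + 4)"
    by (rule log_cost_le) (use val_le[OF Sub.prems, of "Sub e1 e2"] in simp)
  then have "expr_cost (Sub e1 e2) s \<le>
      (n + 2) ^ expr_deg e1 + (n + 2) ^ expr_deg e2 + (n + 2) ^ (expr_size (Sub e1 e2) + 4)"
    using Sub by (simp del: expr_size.simps)
  also have "\<dots> \<le> (n + 2) ^ (expr_deg e1 + expr_deg e2 + (expr_size (Sub e1 e2) + 4) + 2)"
    by (rule pow_add3_le) simp
  also have "expr_deg e1 + expr_deg e2 + (expr_size (Sub e1 e2) + 4) + 2 = expr_deg (Sub e1 e2)" by simp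
  finally show ?case .
qed

section \<open>Program logic for total correctness with time bounds\<close>

definition runs :: "nat \<Rightarrow> prog \<Rightarrow> store \<Rightarrow> (store \<Rightarrow> bool) \<Rightarrow> bool" where
  "runs n p s Q \<longleftrightarrow> (\<exists>t s'. exec p s t s' \<and> t \<le> (n + 2) ^ prog_deg p \<and> ok n s' \<and> Q s')"

abbreviation same_except :: "string set \<Rightarrow> store \<Rightarrow> store \<Rightarrow> bool" where
  "same_except W s s' \<equiv> \<forall>a. a \<notin> W \<longrightarrow> s' a = s a"

lemma runs_conseq:
  assumes "runs n p s R" "\<And>s'. ok n s' \<Longrightarrow> same_except (writes p) s s' \<Longrightarrow> R s' \<Longrightarrow> Q s'"
  shows "runs n p s Q"
  using assms exec_writes unfolding runs_def by meson

lemma runs_Skip: "ok n s \<Longrightarrow> Q s \<Longrightarrow> runs n Skip s Q"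
  unfolding runs_def by (intro exI[of _ 1] exI[of _ s] conjI exec.Skip) simp_all

lemma runs_Store:
  assumes "ok n s" "a \<noteq> ''n''" "val e2 s \<le> cap n" "Q (s(a := (s a)(val e1 s := val e2 s)))"
  shows "runs n (Store a e1 e2) s Q"
proof -
  have "1 + expr_cost e1 s + expr_cost e2 s \<le> (n + 2) ^ 0 + (n + 2) ^ expr_deg e1 + (n + 2) ^ expr_deg e2"
    using expr_cost_le[OF assms(1), of e1] expr_cost_le[OF assms(1), of e2] by simp
  also have "\<dots> \<le> (n + 2) ^ (0 + expr_deg e1 + expr_deg e2 + 2)" by (rule pow_add3_le) simp
  finally have "1 + expr_cost e1 s + expr_cost e2 s \<le> (n + 2) ^ prog_deg (Store a e1 e2)" by simp
  moreover have "ok n (s(a := (s a)(val e1 s := val e2 s)))"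
    using assms by (simp add: ok_def)
  ultimately show ?thesis unfolding runs_def using assms(4) exec.Store by blast
qed

lemma runs_Seq:
  assumes "runs n p s R"
    and "\<And>s'. ok n s' \<Longrightarrow> same_except (writes p) s s' \<Longrightarrow> R s' \<Longrightarrow> runs n q s' Q"
  shows "runs n (Seq p q) s Q"
proof -
  obtain t1 s1 where 1: "exec p s t1 s1" "t1 \<le> (n + 2) ^ prog_deg p" "ok n s1" "R s1"
    using assms(1) unfolding runs_def by blast
  then have "runs n q s1 Q" using exec_writes by (intro assms(2)) auto
  then obtain t2 s2 where 2: "exec q s1 t2 s2" "t2 \<le> (n + 2) ^ prog_deg q" "ok n s2" "Q s2"
    unfolding runs_def by blast
  have "t1 + t2 \<le> (n + 2) ^ prog_deg (Seq p q)"
    using pow_add_le[of "n + 2" "prog_deg p" "prog_deg q"] 1(2) 2(2) by simp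
  then show ?thesis unfolding runs_def using exec.Seq[OF 1(1) 2(1)] 2 by blast
qed

lemma runs_If:
  assumes "ok n s" "val e s \<noteq> 0 \<Longrightarrow> runs n p s Q" "val e s = 0 \<Longrightarrow> runs n q s Q"
  shows "runs n (IfNZ e p q) s Q"
proof -
  have *: "1 + expr_cost e s + t \<le> (n + 2) ^ prog_deg (IfNZ e p q)"
    if "t \<le> (n + 2) ^ prog_deg p \<or> t \<le> (n + 2) ^ prog_deg q" for t
  proof -
    have "(n + 2) ^ prog_deg p \<le> (n + 2) ^ (prog_deg p + prog_deg q)"
      "(n + 2) ^ prog_deg q \<le> (n + 2) ^ (prog_deg p + prog_deg q)"
      by (rule power_increasing; simp)+
    then have "t \<le> (n + 2) ^ (prog_deg p + prog_deg q)" using that by (meson order_trans)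
    then have "1 + expr_cost e s + t \<le> (n + 2) ^ 0 + (n + 2) ^ expr_deg e + (n + 2) ^ (prog_deg p + prog_deg q)"
      using expr_cost_le[OF assms(1), of e] by (intro add_mono) simp_all
    also have "\<dots> \<le> (n + 2) ^ (0 + expr_deg e + (prog_deg p + prog_deg q) + 2)"
      by (rule pow_add3_le) simp
    finally show ?thesis by (simp add: add.assoc)
  qed
  show ?thesis
  proof (cases "val e s = 0")
    case True
    then show ?thesis using assms(3) * exec.IfFalse[OF True] unfolding runs_def by meson
  next
    case False
    then show ?thesis using assms(2) * exec.IfTrue[OF False] unfolding runs_def by meson
  qed
qed

text \<open>The potential is not limited by \<open>n\<close>, so loops with exponentially many
  rounds are covered. The 1 in \<open>\<mu> s + 1\<close> pays for the final, failing test.\<close>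

lemma while_potential:
  fixes \<mu> :: "store \<Rightarrow> nat"
  assumes step: "\<And>s. I s \<Longrightarrow> ok n s \<Longrightarrow> val e s \<noteq> 0 \<Longrightarrow> runs n p s (\<lambda>s'. I s' \<and> \<mu> s' < \<mu> s)"
    and "I s" "ok n s"
  shows "\<exists>t s'. exec (WhileNZ e p) s t s' \<and> t \<le> (\<mu> s + 1) * (n + 2) ^ (expr_deg e + prog_deg p + 2)
     \<and> ok n s' \<and> I s' \<and> val e s' = 0"
  using assms(2,3)
proof (induction "\<mu> s" arbitrary: s rule: less_induct)
  case less
  let ?B = "(n + 2) ^ (expr_deg e + prog_deg p + 2)"
  have cost: "1 + expr_cost e s + t \<le> ?B" if "t \<le> (n + 2) ^ prog_deg p" for t
  proof -
    have "1 + expr_cost e s + t \<le> (n + 2) ^ 0 + (n + 2) ^ expr_deg e + (n + 2) ^ prog_deg p"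
      using that expr_cost_le[OF less.prems(2), of e] by auto
    also have "\<dots> \<le> (n + 2) ^ (0 + expr_deg e + prog_deg p + 2)"
      by (rule pow_add3_le) simp
    finally show ?thesis by (simp add: add.assoc)
  qed
  show ?case
  proof (cases "val e s = 0")
    case True
    have "1 + expr_cost e s \<le> (\<mu> s + 1) * ?B" using cost[of 0] by simp
    then show ?thesis using exec.WhileFalse[OF True] less.prems True by blast
  next
    case False
    then obtain t1 s1 where 1: "exec p s t1 s1" "t1 \<le> (n + 2) ^ prog_deg p" "ok n s1" "I s1" "\<mu> s1 < \<mu> s"
      using step[OF less.prems False] unfolding runs_def by blast
    then obtain t2 s2 where 2: "exec (WhileNZ e p) s1 t2 s2" "t2 \<le> (\<mu> s1 + 1) * ?B" "ok n s2" "I s2" "val e s2 = 0"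
      using less.hyps[OF 1(5,4,3)] by blast
    have "(\<mu> s1 + 1) * ?B \<le> \<mu> s * ?B" using 1(5) by (intro mult_le_mono1) simp
    then have "1 + expr_cost e s + t1 + t2 \<le> (\<mu> s + 1) * ?B"
      using cost[OF 1(2)] 2(2) by simp
    then show ?thesis using exec.WhileTrue[OF False 1(1) 2(1)] 2 by blast
  qed
qed

lemma runs_While:
  fixes \<mu> :: "store \<Rightarrow> nat"
  assumes step: "\<And>s. I s \<Longrightarrow> ok n s \<Longrightarrow> val e s \<noteq> 0 \<Longrightarrow> runs n p s (\<lambda>s'. I s' \<and> \<mu> s' < \<mu> s)"
    and "I s" "ok n s" "\<mu> s \<le> n"
    and Q: "\<And>s'. ok n s' \<Longrightarrow> same_except (writes p) s s' \<Longrightarrow> I s' \<Longrightarrow> val e s' = 0 \<Longrightarrow> Q s'"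
  shows "runs n (WhileNZ e p) s Q"
proof -
  obtain t s' where *: "exec (WhileNZ e p) s t s'"
     "t \<le> (\<mu> s + 1) * (n + 2) ^ (expr_deg e + prog_deg p + 2)" "ok n s'" "I s'" "val e s' = 0"
    using while_potential[of I n e p \<mu> s, OF step assms(2,3)] by blast
  have "(\<mu> s + 1) * (n + 2) ^ (expr_deg e + prog_deg p + 2) \<le> (n + 2) * (n + 2) ^ (expr_deg e + prog_deg p + 2)"
    using assms(4) by (intro mult_le_mono1) simp
  also have "\<dots> = (n + 2) ^ prog_deg (WhileNZ e p)"
    by (subst power_Suc[symmetric]) (simp add: eval_nat_numeral)
  finally have "t \<le> (n + 2) ^ prog_deg (WhileNZ e p)" using *(2) by (rule order_trans[rotated])
  moreover have "Q s'" using Q[OF *(3) _ *(4,5)] exec_writes[OF *(1)] by simp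
  ultimately show ?thesis unfolding runs_def using * by blast
qed

definition for_loop :: "string \<Rightarrow> prog \<Rightarrow> prog" where
  "for_loop i p = Seq (Store i (Const 0) (Const 0)) (WhileNZ (Sub (Var ''n'') (Var i))
     (Seq p (Store i (Const 0) (Add (Var i) (Const 1)))))"

lemma writes_for_loop [simp]: "writes (for_loop i p) = insert i (writes p)"
  by (auto simp: for_loop_def)

lemma le_cap: "v \<le> n \<Longrightarrow> v \<le> cap n"
proof -
  assume "v \<le> n"
  also have "n \<le> 2 ^ n" by (rule less_imp_le) simp
  also have "(2::nat) ^ n \<le> 16 ^ n" by (rule power_mono) auto
  also have "(16::nat) ^ n \<le> 16 ^ (n + 2)" by (rule power_increasing) auto
  finally show ?thesis unfolding cap_def .
qed

lemma one_le_cap: "1 \<le> cap n" "Suc 0 \<le> cap n"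
  unfolding cap_def by simp_all

text \<open>\<open>I\<close> may speak about the counter, so \<open>step\<close> establishes it for
  the store after the increment that follows the body.\<close>

lemma runs_for:
  assumes "ok n s" "i \<noteq> ''n''" "i \<notin> writes p"
    and init: "I 0 (set_var s i 0)"
    and step: "\<And>j s'. j < n \<Longrightarrow> ok n s' \<Longrightarrow> same_except (insert i (writes p)) s s' \<Longrightarrow> s' i 0 = j \<Longrightarrow> I j s'
       \<Longrightarrow> runs n p s' (\<lambda>s''. I (Suc j) (set_var s'' i (Suc j)))"
    and Q: "\<And>s'. ok n s' \<Longrightarrow> same_except (insert i (writes p)) s s' \<Longrightarrow> I n s' \<Longrightarrow> Q s'"
  shows "runs n (for_loop i p) s Q"
  unfolding for_loop_def
proof (rule runs_Seq[OF runs_Store])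
  fix s0 assume s0: "ok n s0" "s0 = set_var s i 0"
  let ?I = "\<lambda>s'. s' i 0 \<le> n \<and> I (s' i 0) s' \<and> same_except (insert i (writes p)) s s'"
  show "runs n (WhileNZ (Sub (Var ''n'') (Var i)) (Seq p (Store i (Const 0) (Add (Var i) (Const 1))))) s0 Q"
  proof (rule runs_While[where I = ?I and \<mu> = "\<lambda>s'. n - s' i 0"])
    show "?I s0" using s0(2) init by simp
    fix s1 assume 1: "?I s1" "ok n s1" "val (Sub (Var ''n'') (Var i)) s1 \<noteq> 0"
    then have j: "s1 i 0 < n" by (simp add: ok_def)
    show "runs n (Seq p (Store i (Const 0) (Add (Var i) (Const 1)))) s1
       (\<lambda>s'. ?I s' \<and> n - s' i 0 < n - s1 i 0)"
    proof (rule runs_Seq[OF step[OF j 1(2) _ refl]])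
      fix s2 assume 2: "ok n s2" "same_except (writes p) s1 s2" "I (Suc (s1 i 0)) (set_var s2 i (Suc (s1 i 0)))"
      then have i2: "s2 i 0 = s1 i 0" using assms(3) by simp
      show "runs n (Store i (Const 0) (Add (Var i) (Const 1))) s2 (\<lambda>s'. ?I s' \<and> n - s' i 0 < n - s1 i 0)"
        by (rule runs_Store[OF 2(1) assms(2)])
          (use i2 j 2 1 assms(3) le_cap[of "Suc (s1 i 0)" n] in auto)
    qed (use 1 in auto)
  next
    fix s' assume "?I s'" "ok n s'" "val (Sub (Var ''n'') (Var i)) s' = 0"
    then have "s' i 0 = n" by (simp add: ok_def)
    then show "Q s'" using Q \<open>?I s'\<close> \<open>ok n s'\<close> by blast
  qed (use s0 in auto)
qed (use assms in auto)

section \<open>Deciding first-order formulas over the vertices\<close>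

text \<open>Matrix entries and the search for the seven vertices are all formulas with variables
  ranging over \<open>{..<n}\<close>. One compiler with one correctness proof thus replaces a
  separate nest of loops for each.\<close>

datatype fm = Nz expr | Neg fm | Conj fm fm | Ex string fm

primrec holds :: "fm \<Rightarrow> store \<Rightarrow> bool" where
  "holds (Nz e) s \<longleftrightarrow> val e s \<noteq> 0"
| "holds (Neg f) s \<longleftrightarrow> \<not> holds f s"
| "holds (Conj f g) s \<longleftrightarrow> holds f s \<and> holds g s"
| "holds (Ex x f) s \<longleftrightarrow> (\<exists>v < s ''n'' 0. holds f (set_var s x v))"

primrec reads :: "expr \<Rightarrow> string set" where
  "reads (Const v) = {}"
| "reads (Load a e) = insert a (reads e)"
| "reads (Add e1 e2) = reads e1 \<union> reads e2"
| "reads (Sub e1 e2) = reads e1 \<union> reads e2"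

primrec free :: "fm \<Rightarrow> string set" where
  "free (Nz e) = reads e"
| "free (Neg f) = free f"
| "free (Conj f g) = free f \<union> free g"
| "free (Ex x f) = free f - {x}"

primrec bound :: "fm \<Rightarrow> string set" where
  "bound (Nz e) = {}"
| "bound (Neg f) = bound f"
| "bound (Conj f g) = bound f \<union> bound g"
| "bound (Ex x f) = insert x (bound f)"

text \<open>\<open>check\<close> overwrites the registers of bound variables. So the first conjunct
  must not destroy what the second one reads, and the body of a quantifier, which is run repeatedly,
  must destroy neither its own input nor the search variable.\<close>

primrec well_named :: "fm \<Rightarrow> bool" where
  "well_named (Nz e) \<longleftrightarrow> True"
| "well_named (Neg f) \<longleftrightarrow> well_named f"
| "well_named (Conj f g) \<longleftrightarrow> well_named f \<and> well_named g \<and> bound f \<inter> free g = {}"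
| "well_named (Ex x f) \<longleftrightarrow> well_named f \<and> x \<notin> bound f \<and> bound f \<inter> free f = {}"

text \<open>The search for a witness of \<^const>\<open>Ex\<close> stops as soon as one is found, so the variables of an
  existential prefix are left holding a witness.\<close>

primrec witness :: "fm \<Rightarrow> store \<Rightarrow> bool" where
  "witness (Nz e) s \<longleftrightarrow> True"
| "witness (Neg f) s \<longleftrightarrow> True"
| "witness (Conj f g) s \<longleftrightarrow> True"
| "witness (Ex x f) s \<longleftrightarrow> s x 0 < s ''n'' 0 \<and> holds f s \<and> witness f s"

text \<open>The register \<open>r\<close> receives \<open>n\<close> for true and 0 for false: with \<open>n\<close> instead of 1, adding \<open>r\<close>
  to the loop variable ends a search. This needs \<open>n > 0\<close>.\<close>

primrec check :: "fm \<Rightarrow> prog" where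
  "check (Nz e) = IfNZ e (Store ''r'' (Const 0) (Var ''n'')) (Store ''r'' (Const 0) (Const 0))"
| "check (Neg f) = Seq (check f) (Store ''r'' (Const 0) (Sub (Var ''n'') (Var ''r'')))"
| "check (Conj f g) = Seq (check f) (IfNZ (Var ''r'') (check g) Skip)"
| "check (Ex x f) = Seq (Store x (Const 0) (Const 0)) (Seq (Store ''r'' (Const 0) (Const 0))
     (WhileNZ (Sub (Var ''n'') (Add (Var x) (Var ''r'')))
       (Seq (check f) (IfNZ (Var ''r'') Skip (Store x (Const 0) (Add (Var x) (Const 1)))))))"

lemma writes_check [simp]: "writes (check f) = insert ''r'' (bound f)"
  by (induction f) auto

lemma val_cong: "(\<And>a. a \<in> reads e \<Longrightarrow> s a = s' a) \<Longrightarrow> val e s = val e s'"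
  by (induction e) auto

text \<open>A quantifier sets only cell 0 of its variable; other cells of that array are still read
  from the store and have to agree.\<close>

lemma holds_cong:
  "(\<And>a i. a \<in> free f \<or> a \<in> bound f \<and> i \<noteq> 0 \<Longrightarrow> s a i = s' a i) \<Longrightarrow> s ''n'' 0 = s' ''n'' 0
    \<Longrightarrow> ''n'' \<notin> bound f \<Longrightarrow> holds f s = holds f s'"
proof (induction f arbitrary: s s')
  case (Nz e)
  have "val e s = val e s'" by (rule val_cong, rule ext) (use Nz.prems in auto)
  then show ?case by simp
next
  case (Neg f)
  have "holds f s = holds f s'" by (rule Neg.IH) (use Neg.prems in auto)
  then show ?case by simp
next
  case (Conj f g)
  have "holds f s = holds f s'" by (rule Conj.IH) (use Conj.prems in auto)
  moreover have "holds g s = holds g s'" by (rule Conj.IH) (use Conj.prems in auto)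
  ultimately show ?case by simp
next
  case (Ex x f)
  have "holds f (set_var s x v) = holds f (set_var s' x v)" for v
    by (rule Ex.IH) (use Ex.prems in auto)
  then show ?case using Ex.prems by simp
qed

definition same_cells :: "string set \<Rightarrow> store \<Rightarrow> store \<Rightarrow> bool" where
  "same_cells B s s' \<longleftrightarrow> (\<forall>a i. a \<notin> B \<or> i \<noteq> 0 \<longrightarrow> s' a i = s a i)"

lemma holds_same_cells:
  "same_cells B s s' \<Longrightarrow> B \<inter> free f = {} \<Longrightarrow> ''n'' \<notin> B \<Longrightarrow> ''n'' \<notin> bound f \<Longrightarrow> holds f s' = holds f s"
  by (rule holds_cong) (auto simp: same_cells_def)

lemma runs_check:
  assumes "0 < n" "well_named f" "''r'' \<notin> free f \<union> bound f" "''n'' \<notin> bound f" "ok n s"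
  shows "runs n (check f) s (\<lambda>s'. same_cells (insert ''r'' (bound f)) s s' \<and>
      s' ''r'' 0 = (if holds f s then n else 0) \<and> (holds f s \<longrightarrow> witness f s'))"
  using assms(2-)
proof (induction f arbitrary: s)
  case (Nz e)
  show ?case
    unfolding check.simps
    by (rule runs_If[OF Nz.prems(4)]; rule runs_Store[OF Nz.prems(4)])
      (use Nz.prems le_cap[of n n] in \<open>auto simp: ok_def same_cells_def\<close>)
next
  case (Neg f)
  have n: "s ''n'' 0 = n" using Neg.prems by (simp add: ok_def)
  show ?case
    unfolding check.simps
    by (rule runs_Seq[OF Neg.IH]; (rule runs_Store)?)
      (use Neg.prems le_cap[of _ n] in \<open>auto simp: ok_def same_cells_def\<close>)
next
  case (Conj f g)
  show ?case
    unfolding check.simps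
  proof (rule runs_Seq[OF Conj.IH(1)])
    fix s1 assume 1: "ok n s1" "same_cells (insert ''r'' (bound f)) s s1 \<and>
        s1 ''r'' 0 = (if holds f s then n else 0) \<and> (holds f s \<longrightarrow> witness f s1)"
    have g: "holds g s1 = holds g s"
      by (rule holds_same_cells) (use 1 Conj.prems in auto)
    show "runs n (IfNZ (Var ''r'') (check g) Skip) s1
       (\<lambda>s'. same_cells (insert ''r'' (bound (Conj f g))) s s' \<and>
          s' ''r'' 0 = (if holds (Conj f g) s then n else 0) \<and> (holds (Conj f g) s \<longrightarrow> witness (Conj f g) s'))"
    proof (rule runs_If[OF 1(1)])
      assume "val (Var ''r'') s1 \<noteq> 0"
      then have f: "holds f s" using 1(2) by (auto split: if_splits)
      show "runs n (check g) s1
       (\<lambda>s'. same_cells (insert ''r'' (bound (Conj f g))) s s' \<and>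
          s' ''r'' 0 = (if holds (Conj f g) s then n else 0) \<and> (holds (Conj f g) s \<longrightarrow> witness (Conj f g) s'))"
      proof (rule runs_conseq[OF Conj.IH(2)])
        fix s2 assume "same_cells (insert ''r'' (bound g)) s1 s2 \<and>
            s2 ''r'' 0 = (if holds g s1 then n else 0) \<and> (holds g s1 \<longrightarrow> witness g s2)"
        then show "same_cells (insert ''r'' (bound (Conj f g))) s s2 \<and>
          s2 ''r'' 0 = (if holds (Conj f g) s then n else 0) \<and> (holds (Conj f g) s \<longrightarrow> witness (Conj f g) s2)"
          using f g 1(2) by (auto simp: same_cells_def)
      qed (use Conj.prems 1 in auto)
    next
      assume "val (Var ''r'') s1 = 0"
      then have "\<not> holds f s" using 1(2) assms(1) by (auto split: if_splits)
      then show "runs n Skip s1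
       (\<lambda>s'. same_cells (insert ''r'' (bound (Conj f g))) s s' \<and>
          s' ''r'' 0 = (if holds (Conj f g) s then n else 0) \<and> (holds (Conj f g) s \<longrightarrow> witness (Conj f g) s'))"
        using 1 by (intro runs_Skip) (auto simp: same_cells_def)
    qed
  qed (use Conj.prems in auto)
next
  case (Ex x f)
  have names: "well_named f" "''r'' \<notin> free f \<union> bound f" "''n'' \<notin> bound f" "x \<noteq> ''r''" "x \<noteq> ''n''"
      "x \<notin> bound f" "bound f \<inter> free f = {}"
    using Ex.prems by auto
  let ?B = "insert ''r'' (insert x (bound f))"
  let ?H = "\<lambda>v. holds f (set_var s x v)"
  let ?found = "\<lambda>s'. s' ''r'' 0 = n \<and> s' x 0 < n \<and> ?H (s' x 0) \<and> holds f s' \<and> witness f s'"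
  \<comment> \<open>Either all values below the search variable have failed, or it holds a witness
    and \<open>r = n\<close>, which turns the condition \<open>n - (x + r)\<close> to zero. The same
    difference is the potential.\<close>
  let ?I = "\<lambda>s'. same_cells ?B s s' \<and>
     (s' ''r'' 0 = 0 \<and> s' x 0 \<le> n \<and> (\<forall>v < s' x 0. \<not> ?H v) \<or> ?found s')"
  let ?body = "Seq (check f) (IfNZ (Var ''r'') Skip (Store x (Const 0) (Add (Var x) (Const 1))))"
  let ?cond = "Sub (Var ''n'') (Add (Var x) (Var ''r''))"
  have n: "s ''n'' 0 = n" using Ex.prems by (simp add: ok_def)
  have loop: "runs n (WhileNZ ?cond ?body) s0 (\<lambda>s'. same_cells (insert ''r'' (bound (Ex x f))) s s' \<and>
      s' ''r'' 0 = (if holds (Ex x f) s then n else 0) \<and> (holds (Ex x f) s \<longrightarrow> witness (Ex x f) s'))"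
    if s0: "ok n s0" "s0 = set_var (set_var s x 0) ''r'' 0" for s0
  proof (rule runs_While[where I = ?I and \<mu> = "\<lambda>s'. n - (s' x 0 + s' ''r'' 0)"])
    show "?I s0" using s0(2) names(4) by (simp add: same_cells_def)
    show "ok n s0" by (rule s0)
    show "n - (s0 x 0 + s0 ''r'' 0) \<le> n" by simp
    fix s1 assume 1: "?I s1" "ok n s1" "val ?cond s1 \<noteq> 0"
    then have lt: "s1 x 0 + s1 ''r'' 0 < n" by (simp add: ok_def)
    then have r: "s1 ''r'' 0 = 0" "s1 x 0 < n" "\<forall>v < s1 x 0. \<not> ?H v" and s1: "same_cells ?B s s1"
      using 1(1) by auto
    have "same_cells (insert ''r'' (bound f)) (set_var s x (s1 x 0)) s1"
      using s1 by (auto simp: same_cells_def)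
    then have H: "holds f s1 = ?H (s1 x 0)"
      by (rule holds_same_cells) (use names in auto)
    show "runs n ?body s1 (\<lambda>s'. ?I s' \<and> n - (s' x 0 + s' ''r'' 0) < n - (s1 x 0 + s1 ''r'' 0))"
    proof (rule runs_Seq[OF Ex.IH])
      fix s2 assume 2: "ok n s2" "same_cells (insert ''r'' (bound f)) s1 s2 \<and>
         s2 ''r'' 0 = (if holds f s1 then n else 0) \<and> (holds f s1 \<longrightarrow> witness f s2)"
      then have H2: "holds f s2 = holds f s1"
        by (intro holds_same_cells[of "insert ''r'' (bound f)"]) (use names in auto)
      have x2: "s2 x 0 = s1 x 0" using 2(2) names by (simp add: same_cells_def)
      have s2: "same_cells ?B s s2" using s1 2(2) unfolding same_cells_def by auto
      show "runs n (IfNZ (Var ''r'') Skip (Store x (Const 0) (Add (Var x) (Const 1)))) s2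
         (\<lambda>s'. ?I s' \<and> n - (s' x 0 + s' ''r'' 0) < n - (s1 x 0 + s1 ''r'' 0))"
      proof (rule runs_If[OF 2(1)])
        assume "val (Var ''r'') s2 \<noteq> 0"
        then have "holds f s1" using 2(2) by (auto split: if_splits)
        then show "runs n Skip s2 (\<lambda>s'. ?I s' \<and> n - (s' x 0 + s' ''r'' 0) < n - (s1 x 0 + s1 ''r'' 0))"
          using 2 H H2 x2 s2 r by (intro runs_Skip) auto
      next
        assume "val (Var ''r'') s2 = 0"
        then have f: "\<not> holds f s1" "s2 ''r'' 0 = 0" using 2(2) assms(1) by (auto split: if_splits)
        show "runs n (Store x (Const 0) (Add (Var x) (Const 1))) s2
           (\<lambda>s'. ?I s' \<and> n - (s' x 0 + s' ''r'' 0) < n - (s1 x 0 + s1 ''r'' 0))"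
        proof (rule runs_Store[OF 2(1) names(5)])
          show "val (Add (Var x) (Const 1)) s2 \<le> cap n" using r x2 by (intro le_cap) simp
          have "same_cells ?B s (set_var s2 x (Suc (s1 x 0)))"
            using s2 by (simp add: same_cells_def)
          then show "?I (s2(x := (s2 x)(val (Const 0) s2 := val (Add (Var x) (Const 1)) s2))) \<and>
              n - ((s2(x := (s2 x)(val (Const 0) s2 := val (Add (Var x) (Const 1)) s2))) x 0 +
                (s2(x := (s2 x)(val (Const 0) s2 := val (Add (Var x) (Const 1)) s2))) ''r'' 0)
              < n - (s1 x 0 + s1 ''r'' 0)"
            using r x2 f H names(4) by (auto simp: less_Suc_eq)
        qed
      qed
    qed (use names 1 in auto)
  next
    fix s' assume s': "ok n s'" "?I s'" "val ?cond s' = 0"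
    then have "n \<le> s' x 0 + s' ''r'' 0" by (simp add: ok_def)
    with s' show "same_cells (insert ''r'' (bound (Ex x f))) s s' \<and>
      s' ''r'' 0 = (if holds (Ex x f) s then n else 0) \<and> (holds (Ex x f) s \<longrightarrow> witness (Ex x f) s')"
      using assms(1) n by (auto simp: ok_def insert_commute)
  qed
  show ?case
    unfolding check.simps
  proof (rule runs_Seq[OF runs_Store])
    fix s1 assume 1: "ok n s1" "s1 = set_var s x 0"
    show "runs n (Seq (Store ''r'' (Const 0) (Const 0)) (WhileNZ ?cond ?body)) s1
      (\<lambda>s'. same_cells (insert ''r'' (bound (Ex x f))) s s' \<and>
        s' ''r'' 0 = (if holds (Ex x f) s then n else 0) \<and> (holds (Ex x f) s \<longrightarrow> witness (Ex x f) s'))"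
    proof (rule runs_Seq[OF runs_Store])
      fix s0 assume "ok n s0" "s0 = set_var s1 ''r'' 0"
      then show "runs n (WhileNZ ?cond ?body) s0 (\<lambda>s'. same_cells (insert ''r'' (bound (Ex x f))) s s' \<and>
        s' ''r'' 0 = (if holds (Ex x f) s then n else 0) \<and> (holds (Ex x f) s \<longrightarrow> witness (Ex x f) s'))"
        using 1 by (intro loop) simp_all
    qed (use 1 in auto)
  qed (use Ex.prems names in auto)
qed

section \<open>Searching for a branching pair\<close>

lemma index_eq_iff:
  fixes u v u' v' n :: nat
  assumes "v < n" "v' < n"
  shows "u * n + v = u' * n + v' \<longleftrightarrow> u = u' \<and> v = v'"
proof
  assume eq: "u * n + v = u' * n + v'"
  have "(u * n + v) div n = u" "(u' * n + v') div n = u'" using assms by simp_all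
  then show "u = u' \<and> v = v'" using eq by simp
qed simp

text \<open>The machine cannot multiply: \<open>m\<close> is a table with \<open>m[v] = v * n\<close>, filled once, by which the
  programs address \<open>n \<times> n\<close> matrices. The array \<open>c\<close> holds the surviving vertices, and \<open>p\<close> and \<open>q\<close>
  hold the matrices of Warshall's algorithm.\<close>

definition mat_set :: "string \<Rightarrow> fm \<Rightarrow> prog" where
  "mat_set a f = for_loop ''x'' (for_loop ''y'' (Seq (check f)
     (Store a (Add (Load ''m'' (Var ''x'')) (Var ''y'')) (Var ''r''))))"

lemma writes_mat_set [simp]: "writes (mat_set a f) = {a, ''r'', ''x'', ''y''} \<union> bound f"
  by (auto simp: mat_set_def)

text \<open>\<open>f\<close> refers to the initial store although \<open>a\<close> is being filled
  meanwhile, so \<open>a\<close> must not occur in \<open>f\<close>. This is why a round of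
  Warshall's algorithm goes from \<open>p\<close> to \<open>q\<close> and is then copied
  back.\<close>

lemma runs_mat_set:
  assumes n: "0 < n" "ok n s" and f: "well_named f" "bound f \<inter> free f = {}"
      "bound f \<inter> {''r'', ''n'', ''m'', ''x'', ''y'', a} = {}" "''r'' \<notin> free f"
    and a: "a \<notin> free f" "a \<notin> {''r'', ''n'', ''m'', ''x'', ''y''}"
    and m: "\<And>v. v < n \<Longrightarrow> s ''m'' v = v * n"
    and Q: "\<And>s'. ok n s' \<Longrightarrow> same_except ({a, ''r'', ''x'', ''y''} \<union> bound f) s s' \<Longrightarrow>
       (\<And>u v. u < n \<Longrightarrow> v < n \<Longrightarrow> s' a (u * n + v) \<noteq> 0 \<longleftrightarrow> holds f (set_var (set_var s ''x'' u) ''y'' v))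
       \<Longrightarrow> Q s'"
  shows "runs n (mat_set a f) s Q"
proof -
  define V where "V = {''r'', ''x'', ''y''} \<union> bound f"
  \<comment> \<open>\<open>J\<close> is the frame condition and \<open>P\<close> the correctness of
    one entry. Both ignore cell 0 of the names in \<open>V\<close>, so setting the loop counters
    does not disturb them.\<close>
  define J where "J = (\<lambda>s'. \<forall>b i. b \<noteq> a \<and> \<not> (b \<in> V \<and> i = 0) \<longrightarrow> s' b i = s b i)"
  define P where "P = (\<lambda>s' u v. s' a (u * n + v) \<noteq> (0::nat) \<longleftrightarrow> holds f (set_var (set_var s ''x'' u) ''y'' v))"
  have JV: "J (set_var s' x v) = J s'" if "x \<in> V" for s' x v
    using that unfolding J_def by auto
  have PV: "P (set_var s' x v) = P s'" if "x \<in> V" for s' x v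
    using that a f(3) unfolding P_def V_def by auto
  show ?thesis
    unfolding mat_set_def
  proof (rule runs_for[where I = "\<lambda>u s'. J s' \<and> (\<forall>u'<u. \<forall>v<n. P s' u' v)"])
    show "J (set_var s ''x'' 0) \<and> (\<forall>u'<0. \<forall>v<n. P (set_var s ''x'' 0) u' v)"
      by (simp add: J_def V_def)
    fix u s1 assume u: "u < n" "ok n s1" "s1 ''x'' 0 = u" and 1: "J s1 \<and> (\<forall>u'<u. \<forall>v<n. P s1 u' v)"
    show "runs n (for_loop ''y'' (Seq (check f) (Store a (Add (Load ''m'' (Var ''x'')) (Var ''y'')) (Var ''r'')))) s1
      (\<lambda>s''. J (set_var s'' ''x'' (Suc u)) \<and> (\<forall>u'<Suc u. \<forall>v<n. P (set_var s'' ''x'' (Suc u)) u' v))"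
    proof (rule runs_for[where I = "\<lambda>v s'. s' ''x'' 0 = u \<and> J s' \<and> (\<forall>u'<u. \<forall>v<n. P s' u' v) \<and> (\<forall>v'<v. P s' u v')"])
      show "set_var s1 ''y'' 0 ''x'' 0 = u \<and> J (set_var s1 ''y'' 0) \<and>
          (\<forall>u'<u. \<forall>v<n. P (set_var s1 ''y'' 0) u' v) \<and> (\<forall>v'<0. P (set_var s1 ''y'' 0) u v')"
        using u 1 by (simp add: JV PV V_def)
      fix v s2 assume v: "v < n" "ok n s2" "s2 ''y'' 0 = v"
        and 2: "s2 ''x'' 0 = u \<and> J s2 \<and> (\<forall>u'<u. \<forall>v<n. P s2 u' v) \<and> (\<forall>v'<v. P s2 u v')"
      have H: "holds f s2 = holds f (set_var (set_var s ''x'' u) ''y'' v)"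
      proof (rule holds_cong)
        fix b :: string and i :: nat assume b: "b \<in> free f \<or> b \<in> bound f \<and> i \<noteq> 0"
        then have "b \<noteq> a" and "b \<in> V \<and> i = 0 \<longrightarrow> b = ''x'' \<or> b = ''y''"
          using a f unfolding V_def by auto
        moreover have "s2 b i = s b i" if "b \<noteq> a" "\<not> (b \<in> V \<and> i = 0)"
          using 2 that unfolding J_def by simp
        moreover have "''x'' \<in> V" "''y'' \<in> V" unfolding V_def by simp_all
        ultimately show "s2 b i = set_var (set_var s ''x'' u) ''y'' v b i"
          using 2 v(3) by (cases "b \<in> V \<and> i = 0") auto
      qed (use 2 v n f in \<open>auto simp: ok_def\<close>)
      show "runs n (Seq (check f) (Store a (Add (Load ''m'' (Var ''x'')) (Var ''y'')) (Var ''r''))) s2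
         (\<lambda>s''. set_var s'' ''y'' (Suc v) ''x'' 0 = u \<and> J (set_var s'' ''y'' (Suc v)) \<and>
             (\<forall>u'<u. \<forall>va<n. P (set_var s'' ''y'' (Suc v)) u' va) \<and>
             (\<forall>v'<Suc v. P (set_var s'' ''y'' (Suc v)) u v'))"
      proof (rule runs_Seq[OF runs_check[OF n(1) f(1) _ _ v(2)]])
        fix s3 :: store assume 3: "ok n s3" "same_cells (insert ''r'' (bound f)) s2 s3 \<and>
             s3 ''r'' 0 = (if holds f s2 then n else 0) \<and> (holds f s2 \<longrightarrow> witness f s3)"
        have x3: "s3 ''x'' 0 = u" "s3 ''y'' 0 = v" "s3 a = s2 a"
          using 3(2) 2 v(3) f(3) a(2) by (auto simp: same_cells_def)
        have J3: "J s3"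
          unfolding J_def
        proof (intro allI impI)
          fix b :: string and i :: nat assume b: "b \<noteq> a \<and> \<not> (b \<in> V \<and> i = 0)"
          then have "s3 b i = s2 b i" using 3(2) unfolding same_cells_def V_def by blast
          also have "\<dots> = s b i" using 2 b unfolding J_def by blast
          finally show "s3 b i = s b i" .
        qed
        have "''m'' \<notin> V" "''m'' \<noteq> a" using f(3) a(2) unfolding V_def by auto
        then have m3: "s3 ''m'' u = u * n"
          using m[OF u(1)] J3 unfolding J_def by simp
        have P3: "P s3 = P s2" unfolding P_def x3 ..
        have y: "''y'' \<in> V" unfolding V_def by simp
        let ?s4 = "s3(a := (s3 a)(u * n + v := s3 ''r'' 0))"
        have J4: "J ?s4" using J3 unfolding J_def by simp
        have P4: "P ?s4 u v" unfolding P_def using 3(2) H n(1) by simp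
        have P4': "P ?s4 u' v' = P s2 u' v'" if "v' < n" "(u', v') \<noteq> (u, v)" for u' v'
          using that index_eq_iff[of v' n v u' u] v(1) x3(3) unfolding P_def by auto
        show "runs n (Store a (Add (Load ''m'' (Var ''x'')) (Var ''y'')) (Var ''r'')) s3
         (\<lambda>s''. set_var s'' ''y'' (Suc v) ''x'' 0 = u \<and> J (set_var s'' ''y'' (Suc v)) \<and>
             (\<forall>u'<u. \<forall>va<n. P (set_var s'' ''y'' (Suc v)) u' va) \<and>
             (\<forall>v'<Suc v. P (set_var s'' ''y'' (Suc v)) u v'))"
        proof (rule runs_Store[OF 3(1)])
          show "val (Var ''r'') s3 \<le> cap n" using 3(1) by (simp add: ok_def)
          show "a \<noteq> ''n''" using a by simp
          have eq: "s3(a := (s3 a)(val (Add (Load ''m'' (Var ''x'')) (Var ''y'')) s3 := val (Var ''r'') s3)) = ?s4"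
            using x3(1,2) m3 by simp
          have 4: "set_var ?s4 ''y'' (Suc v) ''x'' 0 = u" using x3(1) a(2) by auto
          have "P ?s4 u v'" if "v' < Suc v" for v'
            using that P4 P4'[of v' u] 2 v(1) by (cases "v' = v") auto
          moreover have "P ?s4 u' v'" if "u' < u" "v' < n" for u' v'
            using that P4'[of v' u'] 2 by auto
          ultimately show "set_var (s3(a := (s3 a)(val (Add (Load ''m'' (Var ''x'')) (Var ''y'')) s3 := val (Var ''r'') s3))) ''y'' (Suc v) ''x'' 0 = u \<and>
             J (set_var (s3(a := (s3 a)(val (Add (Load ''m'' (Var ''x'')) (Var ''y'')) s3 := val (Var ''r'') s3))) ''y'' (Suc v)) \<and>
             (\<forall>u'<u. \<forall>va<n. P (set_var (s3(a := (s3 a)(val (Add (Load ''m'' (Var ''x'')) (Var ''y'')) s3 := val (Var ''r'') s3))) ''y'' (Suc v)) u' va) \<and>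
             (\<forall>v'<Suc v. P (set_var (s3(a := (s3 a)(val (Add (Load ''m'' (Var ''x'')) (Var ''y'')) s3 := val (Var ''r'') s3))) ''y'' (Suc v)) u v')"
            unfolding eq JV[OF y] PV[OF y] using J4 4 by blast
        qed
      qed (use f in auto)
    next
      fix s' :: store assume *: "s' ''x'' 0 = u \<and> J s' \<and> (\<forall>u'<u. \<forall>v<n. P s' u' v) \<and> (\<forall>v'<n. P s' u v')"
      have x: "''x'' \<in> V" unfolding V_def by simp
      show "J (set_var s' ''x'' (Suc u)) \<and> (\<forall>u'<Suc u. \<forall>v<n. P (set_var s' ''x'' (Suc u)) u' v)"
        using * JV[OF x] PV[OF x] by (simp add: less_Suc_eq)
    qed (use u f a in auto)
  next
    fix s' :: store assume *: "ok n s'" "J s' \<and> (\<forall>u'<n. \<forall>v<n. P s' u' v)"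
      "same_except (insert ''x'' (writes (for_loop ''y'' (Seq (check f) (Store a (Add (Load ''m'' (Var ''x'')) (Var ''y'')) (Var ''r'')))))) s s'"
    show "Q s'"
      by (rule Q) (use * in \<open>auto simp: P_def\<close>)
  qed (use n f a in auto)
qed

section \<open>The formulas of the algorithm\<close>

definition alive_fm :: "string \<Rightarrow> fm" where
  "alive_fm x = Nz (Load ''c'' (Var x))"

definition rel_fm :: "string \<Rightarrow> string \<Rightarrow> string \<Rightarrow> fm" where
  "rel_fm a x y = Nz (Load a (Add (Load ''m'' (Var x)) (Var y)))"

text \<open>Subtraction truncates at 0, so at least one difference vanishes and the sum is the
  absolute difference.\<close>

definition neq_fm :: "string \<Rightarrow> string \<Rightarrow> fm" where
  "neq_fm x y = Nz (Add (Sub (Var x) (Var y)) (Sub (Var y) (Var x)))"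

definition adj_fm :: "string \<Rightarrow> string \<Rightarrow> fm" where
  "adj_fm x y = Conj (alive_fm x) (Conj (alive_fm y) (rel_fm ''adj'' x y))"

text \<open>The third bound name is \<open>d\<close> because \<open>c\<close> is the array of
  surviving vertices.\<close>

definition thin_fm :: "string \<Rightarrow> fm" where
  "thin_fm w = Conj (alive_fm w) (Neg (Ex ''a'' (Ex ''b'' (Ex ''d''
     (Conj (adj_fm w ''a'') (Conj (adj_fm w ''b'') (Conj (adj_fm w ''d'')
       (Conj (neq_fm ''a'' ''b'') (Conj (neq_fm ''b'' ''d'') (neq_fm ''a'' ''d''))))))))))"

text \<open>Disjunctions are expressed by De Morgan's law, here \<open>x = y\<close> or an edge, and
  likewise in \<open>step_fm\<close> and \<open>joined_fm\<close>.\<close>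

definition base_fm :: fm where
  "base_fm = Conj (alive_fm ''x'') (Conj (alive_fm ''y'')
     (Neg (Conj (neq_fm ''x'' ''y'') (Neg (rel_fm ''adj'' ''x'' ''y'')))))"

definition step_fm :: fm where
  "step_fm = Neg (Conj (Neg (rel_fm ''p'' ''x'' ''y''))
     (Neg (Conj (thin_fm ''w'') (Conj (rel_fm ''p'' ''x'' ''w'') (rel_fm ''p'' ''w'' ''y'')))))"

definition tri_fm :: fm where
  "tri_fm = Conj (adj_fm ''1'' ''2'') (Conj (adj_fm ''2'' ''3'') (adj_fm ''1'' ''3''))"

definition claw_fm :: fm where
  "claw_fm = Conj (adj_fm ''4'' ''5'') (Conj (adj_fm ''4'' ''6'') (Conj (adj_fm ''4'' ''7'')
     (Conj (neq_fm ''5'' ''6'') (Conj (neq_fm ''6'' ''7'') (Conj (neq_fm ''5'' ''7'')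
     (Conj (Neg (rel_fm ''adj'' ''5'' ''6'')) (Conj (Neg (rel_fm ''adj'' ''6'' ''7''))
       (Neg (rel_fm ''adj'' ''5'' ''7'')))))))))"

definition joined_fm :: fm where
  "joined_fm = Neg (Conj (Neg (rel_fm ''p'' ''1'' ''4'')) (Neg (rel_fm ''p'' ''1'' ''5'')))"

text \<open>The quantifiers form a prefix, so a successful search leaves the vertices to branch on
  in registers: \<open>1\<close> to \<open>3\<close> hold the triangle, \<open>4\<close> the centre
  and \<open>5\<close> to \<open>7\<close> the leaves of the claw.\<close>

definition pair_fm :: fm where
  "pair_fm = Ex ''1'' (Ex ''2'' (Ex ''3'' (Ex ''4'' (Ex ''5'' (Ex ''6'' (Ex ''7''
     (Conj tri_fm (Conj claw_fm joined_fm))))))))"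

lemmas fm_defs = alive_fm_def rel_fm_def neq_fm_def adj_fm_def thin_fm_def base_fm_def step_fm_def
  tri_fm_def claw_fm_def joined_fm_def pair_fm_def

lemma bound_fms [simp]:
  "bound (rel_fm a x y) = {}" "bound (adj_fm x y) = {}" "bound tri_fm = {}" "bound claw_fm = {}"
  "bound joined_fm = {}" "bound base_fm = {}" "bound step_fm = {''a'', ''b'', ''d''}"
  "bound pair_fm = {''1'', ''2'', ''3'', ''4'', ''5'', ''6'', ''7''}"
  by (simp_all add: fm_defs)

lemma free_rel_fm: "free (rel_fm a x y) = {a, ''m'', x, y}"
  by (auto simp: fm_defs)

lemma free_adj_fm: "free (adj_fm x y) = {''c'', ''adj'', ''m'', x, y}"
  by (auto simp: fm_defs)

lemma free_tri_fm: "free tri_fm = {''c'', ''adj'', ''m'', ''1'', ''2'', ''3''}"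
  by (auto simp: tri_fm_def free_adj_fm)

lemma free_claw_fm: "free claw_fm = {''c'', ''adj'', ''m'', ''4'', ''5'', ''6'', ''7''}"
  by (auto simp: claw_fm_def free_adj_fm free_rel_fm neq_fm_def)

lemma free_joined_fm: "free joined_fm = {''p'', ''m'', ''1'', ''4'', ''5''}"
  by (auto simp: joined_fm_def free_rel_fm)

lemma well_named_fms [simp]:
  "well_named (rel_fm a x y)" "well_named (adj_fm x y)" "well_named tri_fm" "well_named claw_fm"
  "well_named joined_fm" "well_named base_fm" "well_named step_fm"
  by (simp_all add: fm_defs)

lemma well_named_pair_fm [simp]: "well_named pair_fm"
  by (simp add: pair_fm_def free_tri_fm free_claw_fm free_joined_fm)

lemma r_notin_free_pair_fm: "''r'' \<notin> free pair_fm"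
  by (simp add: pair_fm_def free_tri_fm free_claw_fm free_joined_fm)

section \<open>Computing thin reachability and finding a pair\<close>

definition reach_prog :: prog where
  "reach_prog = Seq (mat_set ''p'' base_fm)
     (for_loop ''w'' (Seq (mat_set ''q'' step_fm) (mat_set ''p'' (rel_fm ''q'' ''x'' ''y''))))"

definition alive :: "nat \<Rightarrow> store \<Rightarrow> nat set" where
  "alive n s = {v. v < n \<and> s ''c'' v \<noteq> 0}"

lemma alive_upd [simp]: "x \<noteq> ''c'' \<Longrightarrow> alive n (s(x := h)) = alive n s"
  by (simp add: alive_def)

lemma holds_neq [simp]: "holds (neq_fm x y) s \<longleftrightarrow> s x 0 \<noteq> s y 0"
  by (auto simp: neq_fm_def)

locale branching = sym_irrefl_nat E for E :: "nat \<Rightarrow> nat \<Rightarrow> bool" +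
  fixes n :: nat
  assumes n_pos: "0 < n"
begin

text \<open>The data shared by all nodes of the search tree; what differs between nodes is kept
  apart in \<open>alive\<close>.\<close>

definition ctx :: "store \<Rightarrow> bool" where
  "ctx s \<longleftrightarrow> (\<forall>v<n. s ''m'' v = v * n) \<and> (\<forall>u<n. \<forall>v<n. s ''adj'' (u * n + v) \<noteq> 0 \<longleftrightarrow> E u v)
     \<and> s ''n'' 0 = n"

lemma ctx_upd [simp]: "x \<notin> {''m'', ''adj'', ''n''} \<Longrightarrow> ctx (s(x := h)) = ctx s"
  by (auto simp: ctx_def)

lemma holds_alive: "s x 0 < n \<Longrightarrow> holds (alive_fm x) s \<longleftrightarrow> s x 0 \<in> alive n s"
  by (simp add: alive_fm_def alive_def)

lemma holds_rel:
  "ctx s \<Longrightarrow> s x 0 < n \<Longrightarrow> holds (rel_fm a x y) s \<longleftrightarrow> s a (s x 0 * n + s y 0) \<noteq> 0"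
  by (simp add: rel_fm_def ctx_def)

lemma holds_edge:
  "ctx s \<Longrightarrow> s x 0 < n \<Longrightarrow> s y 0 < n \<Longrightarrow> holds (rel_fm ''adj'' x y) s \<longleftrightarrow> E (s x 0) (s y 0)"
  by (simp add: rel_fm_def ctx_def)

lemma holds_adj:
  "ctx s \<Longrightarrow> s x 0 < n \<Longrightarrow> s y 0 < n \<Longrightarrow> holds (adj_fm x y) s \<longleftrightarrow> adj (alive n s) (s x 0) (s y 0)"
  by (simp add: adj_fm_def holds_alive holds_edge adj_def)

lemma ctx_n: "ctx s \<Longrightarrow> s ''n'' 0 = n"
  by (simp add: ctx_def)

lemma adj_lt: "adj (alive n s) u v \<Longrightarrow> u < n \<and> v < n"
  by (auto simp: adj_def alive_def)

lemma holds_thin: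
  assumes "ctx s" "s w 0 < n" "w \<notin> {''a'', ''b'', ''d''}"
  shows "holds (thin_fm w) s \<longleftrightarrow> thin (alive n s) (s w 0)"
proof -
  have "holds (Ex ''a'' (Ex ''b'' (Ex ''d'' (Conj (adj_fm w ''a'') (Conj (adj_fm w ''b'') (Conj (adj_fm w ''d'')
       (Conj (neq_fm ''a'' ''b'') (Conj (neq_fm ''b'' ''d'') (neq_fm ''a'' ''d''))))))))) s \<longleftrightarrow>
     (\<exists>a<n. \<exists>b<n. \<exists>d<n. adj (alive n s) (s w 0) a \<and> adj (alive n s) (s w 0) b \<and> adj (alive n s) (s w 0) d \<and>
        a \<noteq> b \<and> b \<noteq> d \<and> a \<noteq> d)"
    using assms by (simp add: holds_adj ctx_n cong: conj_cong)
  then have "holds (thin_fm w) s \<longleftrightarrow> s w 0 \<in> alive n s \<and>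
     \<not> (\<exists>a<n. \<exists>b<n. \<exists>d<n. adj (alive n s) (s w 0) a \<and> adj (alive n s) (s w 0) b \<and> adj (alive n s) (s w 0) d \<and>
        a \<noteq> b \<and> b \<noteq> d \<and> a \<noteq> d)"
    using assms holds_alive[of s w] unfolding thin_fm_def by (simp only: holds.simps(2,3))
  also have "\<dots> \<longleftrightarrow> thin (alive n s) (s w 0)"
    unfolding thin_def using adj_lt by blast
  finally show ?thesis .
qed

lemma holds_base:
  assumes "ctx s" "u < n" "v < n"
  shows "holds base_fm (set_var (set_var s ''x'' u) ''y'' v) \<longleftrightarrow> thin_reach 0 (alive n s) u v"
  using assms by (auto simp: base_fm_def holds_alive holds_edge thin_reach_def)

lemma holds_step:
  assumes "ctx s" "u < n" "v < n" "s ''w'' 0 = w" "w < n"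
    and "\<And>u v. u < n \<Longrightarrow> v < n \<Longrightarrow> s ''p'' (u * n + v) \<noteq> 0 \<longleftrightarrow> thin_reach w (alive n s) u v"
  shows "holds step_fm (set_var (set_var s ''x'' u) ''y'' v) \<longleftrightarrow> thin_reach (Suc w) (alive n s) u v"
  using assms by (auto simp: step_fm_def holds_rel holds_thin thin_reach_def)

lemma runs_reach:
  assumes "ok n s" "ctx s"
  shows "runs n reach_prog s (\<lambda>s'. \<forall>u<n. \<forall>v<n. s' ''p'' (u * n + v) \<noteq> 0 \<longleftrightarrow> thin_reach n (alive n s) u v)"
  unfolding reach_prog_def
proof (rule runs_Seq[OF runs_mat_set[OF n_pos assms(1)]])
  fix s' :: store assume "\<And>u v. u < n \<Longrightarrow> v < n \<Longrightarrow>
     s' ''p'' (u * n + v) \<noteq> 0 \<longleftrightarrow> holds base_fm (set_var (set_var s ''x'' u) ''y'' v)"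
  then show "\<forall>u<n. \<forall>v<n. s' ''p'' (u * n + v) \<noteq> 0 \<longleftrightarrow> thin_reach 0 (alive n s) u v"
    using holds_base[OF assms(2)] by simp
next
  let ?I = "\<lambda>w s'. \<forall>u<n. \<forall>v<n. s' ''p'' (u * n + v) \<noteq> 0 \<longleftrightarrow> thin_reach w (alive n s) u v"
  fix s0 :: store assume 0: "ok n s0" "?I 0 s0" "same_except (writes (mat_set ''p'' base_fm)) s s0"
  then have s0: "ctx s0" "alive n s0 = alive n s"
    using assms(2) unfolding ctx_def alive_def by (simp_all add: fm_defs)
  show "runs n (for_loop ''w'' (Seq (mat_set ''q'' step_fm) (mat_set ''p'' (rel_fm ''q'' ''x'' ''y'')))) s0 (?I n)"
  proof (rule runs_for[where I = ?I])
    fix w s1 assume w: "w < n" "ok n s1" "s1 ''w'' 0 = w" "?I w s1"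
      and "same_except (insert ''w'' (writes (Seq (mat_set ''q'' step_fm) (mat_set ''p'' (rel_fm ''q'' ''x'' ''y''))))) s0 s1"
    then have s1: "ctx s1" "alive n s1 = alive n s"
      using s0 unfolding ctx_def alive_def by (simp_all add: fm_defs)
    show "runs n (Seq (mat_set ''q'' step_fm) (mat_set ''p'' (rel_fm ''q'' ''x'' ''y''))) s1
        (\<lambda>s'. ?I (Suc w) (set_var s' ''w'' (Suc w)))"
    proof (rule runs_Seq[OF runs_mat_set[OF n_pos w(2)]])
      fix s2 :: store assume "\<And>u v. u < n \<Longrightarrow> v < n \<Longrightarrow>
         s2 ''q'' (u * n + v) \<noteq> 0 \<longleftrightarrow> holds step_fm (set_var (set_var s1 ''x'' u) ''y'' v)"
      then show "\<forall>u<n. \<forall>v<n. s2 ''q'' (u * n + v) \<noteq> 0 \<longleftrightarrow> thin_reach (Suc w) (alive n s) u v"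
        using holds_step[OF s1(1) _ _ w(3,1)] w(4) s1(2) by simp
    next
      fix s2 :: store assume 2: "ok n s2" "same_except (writes (mat_set ''q'' step_fm)) s1 s2"
        "\<forall>u<n. \<forall>v<n. s2 ''q'' (u * n + v) \<noteq> 0 \<longleftrightarrow> thin_reach (Suc w) (alive n s) u v"
      then have s2: "ctx s2"
        using s1 unfolding ctx_def by (simp add: fm_defs)
      show "runs n (mat_set ''p'' (rel_fm ''q'' ''x'' ''y'')) s2 (\<lambda>s'. ?I (Suc w) (set_var s' ''w'' (Suc w)))"
      proof (rule runs_mat_set[OF n_pos 2(1)])
        fix s3 :: store assume "\<And>u v. u < n \<Longrightarrow> v < n \<Longrightarrow>
          s3 ''p'' (u * n + v) \<noteq> 0 \<longleftrightarrow> holds (rel_fm ''q'' ''x'' ''y'') (set_var (set_var s2 ''x'' u) ''y'' v)"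
        then show "?I (Suc w) (set_var s3 ''w'' (Suc w))"
          using 2(3) s2 by (simp add: holds_rel)
      qed (use s2 in \<open>simp_all add: fm_defs ctx_def\<close>)
    qed (use s1 in \<open>simp_all add: fm_defs ctx_def\<close>)
  qed (use 0 in \<open>simp_all add: fm_defs\<close>)
qed (use assms(2) in \<open>simp_all add: fm_defs ctx_def\<close>)

lemma holds_pair_body:
  assumes "ctx s" "s ''1'' 0 < n" "s ''2'' 0 < n" "s ''3'' 0 < n" "s ''4'' 0 < n" "s ''5'' 0 < n"
    "s ''6'' 0 < n" "s ''7'' 0 < n"
    and "\<forall>u<n. \<forall>v<n. s ''p'' (u * n + v) \<noteq> 0 \<longleftrightarrow> thin_reach n (alive n s) u v"
  shows "holds (Conj tri_fm (Conj claw_fm joined_fm)) s \<longleftrightarrow>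
     bad_pair n (alive n s) (s ''1'' 0) (s ''2'' 0) (s ''3'' 0) (s ''4'' 0) (s ''5'' 0) (s ''6'' 0) (s ''7'' 0)"
proof -
  have "holds tri_fm s \<longleftrightarrow> tri (alive n s) (s ''1'' 0) (s ''2'' 0) (s ''3'' 0)"
    using assms(1-8) by (simp add: tri_fm_def holds_adj tri_def)
  moreover have "holds claw_fm s \<longleftrightarrow> claw (alive n s) (s ''4'' 0) (s ''5'' 0) (s ''6'' 0) (s ''7'' 0)"
    using assms(1-8) by (simp add: claw_fm_def holds_adj holds_edge claw_def)
  moreover have "holds joined_fm s \<longleftrightarrow>
      thin_reach n (alive n s) (s ''1'' 0) (s ''4'' 0) \<or> thin_reach n (alive n s) (s ''1'' 0) (s ''5'' 0)"
    using assms by (auto simp add: joined_fm_def holds_rel)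
  ultimately show ?thesis by (simp add: bad_pair_def)
qed

lemma bad_pair_lt: "bad_pair n (alive n s) t u v c x y z \<Longrightarrow>
   t < n \<and> u < n \<and> v < n \<and> c < n \<and> x < n \<and> y < n \<and> z < n"
  unfolding bad_pair_def tri_def claw_def using adj_lt by blast

lemma holds_pair:
  assumes "ctx s" "\<forall>u<n. \<forall>v<n. s ''p'' (u * n + v) \<noteq> 0 \<longleftrightarrow> thin_reach n (alive n s) u v"
  shows "holds pair_fm s \<longleftrightarrow> (\<exists>t u v c x y z. bad_pair n (alive n s) t u v c x y z)"
proof -
  have "holds pair_fm s \<longleftrightarrow> (\<exists>t<n. \<exists>u<n. \<exists>v<n. \<exists>c<n. \<exists>x<n. \<exists>y<n. \<exists>z<n. bad_pair n (alive n s) t u v c x y z)"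
    unfolding pair_fm_def using assms
    by (simp del: holds.simps add: holds.simps(4) holds_pair_body ctx_n cong: conj_cong)
  also have "\<dots> \<longleftrightarrow> (\<exists>t u v c x y z. bad_pair n (alive n s) t u v c x y z)"
  proof
    assume "\<exists>t u v c x y z. bad_pair n (alive n s) t u v c x y z"
    then obtain t u v c x y z where *: "bad_pair n (alive n s) t u v c x y z" by blast
    show "\<exists>t<n. \<exists>u<n. \<exists>v<n. \<exists>c<n. \<exists>x<n. \<exists>y<n. \<exists>z<n. bad_pair n (alive n s) t u v c x y z"
      using bad_pair_lt[OF *] * by metis
  qed blast
  finally show ?thesis .
qed

text \<open>Success is exploited through \<open>witness\<close>, which unfolds to the contents of
  the seven registers; failure through \<open>bad_pair_exists\<close>.\<close>

lemma runs_pair: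
  assumes "ok n s" "ctx s" "\<forall>u<n. \<forall>v<n. s ''p'' (u * n + v) \<noteq> 0 \<longleftrightarrow> thin_reach n (alive n s) u v"
  shows "runs n (check pair_fm) s (\<lambda>s'. if s' ''r'' 0 = 0 then good (alive n s) else
     bad_pair n (alive n s) (s' ''1'' 0) (s' ''2'' 0) (s' ''3'' 0) (s' ''4'' 0) (s' ''5'' 0) (s' ''6'' 0) (s' ''7'' 0))"
proof (rule runs_conseq[OF runs_check[OF n_pos _ _ _ assms(1)]])
  fix s' :: store assume *: "same_except (writes (check pair_fm)) s s'"
    "same_cells (insert ''r'' (bound pair_fm)) s s' \<and>
      s' ''r'' 0 = (if holds pair_fm s then n else 0) \<and> (holds pair_fm s \<longrightarrow> witness pair_fm s')"
  then have s': "ctx s'" "alive n s' = alive n s" "s' ''p'' = s ''p''"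
    using assms(2) unfolding ctx_def alive_def by simp_all
  show "if s' ''r'' 0 = 0 then good (alive n s) else
     bad_pair n (alive n s) (s' ''1'' 0) (s' ''2'' 0) (s' ''3'' 0) (s' ''4'' 0) (s' ''5'' 0) (s' ''6'' 0) (s' ''7'' 0)"
  proof (cases "holds pair_fm s")
    case False
    then have "good (alive n s)"
      using bad_pair_exists[of "alive n s" n] holds_pair[OF assms(2,3)] by (auto simp: alive_def)
    then show ?thesis using False * by simp
  next
    case True
    then have w: "witness pair_fm s'" "s' ''r'' 0 \<noteq> 0" using * n_pos by auto
    from w(1) have "s' ''1'' 0 < n" "s' ''2'' 0 < n" "s' ''3'' 0 < n" "s' ''4'' 0 < n" "s' ''5'' 0 < n"
      "s' ''6'' 0 < n" "s' ''7'' 0 < n" "holds (Conj tri_fm (Conj claw_fm joined_fm)) s'"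
      unfolding pair_fm_def by (simp_all only: witness.simps ctx_n[OF s'(1)])
    then show ?thesis using holds_pair_body[OF s'(1)] assms(3) s' w(2) by simp
  qed
qed (simp_all add: r_notin_free_pair_fm)

end

section \<open>The search tree\<close>

text \<open>The number of nodes of the complete 7-ary tree of depth \<open>b\<close>, that is
  \<open>(7 ^ (b + 1) - 1) / 6\<close>; a node has one child for each of the 3 + 4 vertices of a
  triangle and a claw.\<close>

primrec weight :: "nat \<Rightarrow> nat" where
  "weight 0 = 1"
| "weight (Suc b) = 7 * weight b + 1"

text \<open>The summand 1 carries the induction, as \<open>7 * w + 2 \<le> 7 * (w + 1)\<close>, and
  is the one that \<open>while_potential\<close> asks for.\<close>

lemma weight_le: "weight b + 1 \<le> 2 * 7 ^ b"
  by (induction b) auto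

lemma weight_pos: "1 \<le> weight b"
  by (cases b) auto

lemma weight_branch: "0 < b \<Longrightarrow> 7 * weight (b - 1) + 1 = weight b"
  by (cases b) auto

text \<open>Since \<open>n \<le> 2 ^ n\<close>, the addresses are at most \<open>2 * 14 ^ n\<close>.
  The 16 in \<open>cap\<close> is the next power of two above 14, and the exponent
  \<open>n + 2\<close> leaves room for the factor 2.\<close>

lemma length_le_cap: "j \<le> 2 * 7 ^ n \<Longrightarrow> j * n \<le> cap n" "j \<le> 2 * 7 ^ n \<Longrightarrow> j \<le> cap n"
proof -
  have "n \<le> 2 ^ n" by (rule less_imp_le) simp
  have p: "(7::nat) ^ n * 2 ^ n = 14 ^ n" by (simp flip: power_mult_distrib)
  have "(14::nat) ^ n \<le> 16 ^ n" by (rule power_mono) auto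
  then have c: "2 * 14 ^ n \<le> cap n" unfolding cap_def by (simp add: power_add)
  have "j * n \<le> 2 * 7 ^ n * 2 ^ n" if "j \<le> 2 * 7 ^ n"
    using that \<open>n \<le> 2 ^ n\<close> by (rule mult_le_mono)
  then show "j * n \<le> cap n" if "j \<le> 2 * 7 ^ n"
    using that p c by (simp add: mult.assoc)
  have "(7::nat) ^ n \<le> 14 ^ n" by (rule power_mono) auto
  then show "j \<le> cap n" if "j \<le> 2 * 7 ^ n"
    using that c by linarith
qed

lemma index_lt:
  fixes l i v n :: nat
  assumes "l < i" "v < n"
  shows "l * n + v < i * n"
proof -
  have "l * n + v < Suc l * n" using assms(2) by simp
  also have "\<dots> \<le> i * n" using assms(1) by (intro mult_le_mono1) simp
  finally show ?thesis .
qed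

text \<open>The stack has height \<open>s\<close>. Frame \<open>i\<close> consists of the surviving vertices in \<open>A[i * n ..< (i + 1) * n]\<close>
  and the budget \<open>K[i]\<close>; \<open>B = s * n\<close> is the first free address of \<open>A\<close>, and \<open>u\<close> is the budget of the
  frame that was popped last.\<close>

definition frame :: "nat \<Rightarrow> store \<Rightarrow> nat \<Rightarrow> nat set \<times> nat" where
  "frame n s i = ({v. v < n \<and> s ''A'' (i * n + v) \<noteq> 0}, s ''K'' i)"

definition stack :: "nat \<Rightarrow> store \<Rightarrow> (nat set \<times> nat) list" where
  "stack n s = map (frame n s) [0..<s ''s'' 0]"

definition pop_prog :: prog where
  "pop_prog = Seq (Store ''s'' (Const 0) (Sub (Var ''s'') (Const 1)))
     (Seq (Store ''B'' (Const 0) (Sub (Var ''B'') (Var ''n'')))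
     (Seq (Store ''u'' (Const 0) (Load ''K'' (Var ''s'')))
     (for_loop ''v'' (Store ''c'' (Var ''v'') (Load ''A'' (Add (Var ''B'') (Var ''v'')))))))"

text \<open>The popped node in \<open>c\<close> and \<open>u\<close> is only read, so all seven
  children can be made from it one after another.\<close>

definition push_prog :: "string \<Rightarrow> prog" where
  "push_prog x = Seq (for_loop ''v'' (Store ''A'' (Add (Var ''B'') (Var ''v'')) (Load ''c'' (Var ''v''))))
     (Seq (Store ''A'' (Add (Var ''B'') (Var x)) (Const 0))
     (Seq (Store ''K'' (Var ''s'') (Sub (Var ''u'') (Const 1)))
     (Seq (Store ''s'' (Const 0) (Add (Var ''s'') (Const 1)))
     (Store ''B'' (Const 0) (Add (Var ''B'') (Var ''n''))))))"

primrec push_all :: "string list \<Rightarrow> prog" where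
  "push_all [] = Skip"
| "push_all (x # xs) = Seq (push_prog x) (push_all xs)"

text \<open>A good node sets \<open>out\<close>, but the loop goes on until the stack is empty; the
  potential pays for the whole tree anyway. A bad pair with budget 0 refutes the node, which is then
  simply dropped.\<close>

definition node_prog :: prog where
  "node_prog = Seq pop_prog (Seq reach_prog (Seq (check pair_fm)
     (IfNZ (Var ''r'')
       (IfNZ (Var ''u'') (push_all [''1'', ''2'', ''3'', ''4'', ''5'', ''6'', ''7'']) Skip)
       (Store ''out'' (Const 0) (Const 1)))))"

text \<open>The multiples of \<open>n\<close> are built up by addition from \<open>m[0] = 0\<close>,
  which the input provides. The root is frame 0, so its addresses are the vertices
  themselves.\<close>

definition init_prog :: prog where
  "init_prog = Seq (for_loop ''v'' (Store ''m'' (Add (Var ''v'') (Const 1)) (Add (Load ''m'' (Var ''v'')) (Var ''n''))))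
     (Seq (for_loop ''v'' (Store ''A'' (Var ''v'') (Const 1)))
     (Seq (Store ''K'' (Const 0) (Var ''k''))
     (Seq (Store ''s'' (Const 0) (Const 1))
     (Store ''B'' (Const 0) (Var ''n'')))))"

text \<open>The test is \<open>k < n\<close>. It also guarantees \<open>0 < n\<close>, on which
  \<open>check\<close> relies, and puts the budget below \<open>cap n\<close>.\<close>

definition deletion_prog :: prog where
  "deletion_prog = IfNZ (Sub (Var ''n'') (Var ''k''))
     (Seq init_prog (WhileNZ (Var ''s'') node_prog))
     (Store ''out'' (Const 0) (Const 1))"

lemma writes_push_all: "writes (push_all xs) \<subseteq> {''v'', ''A'', ''K'', ''s'', ''B''}"
  by (induction xs) (auto simp: push_prog_def)

lemma length_stack [simp]: "length (stack n s) = s ''s'' 0"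
  by (simp add: stack_def)

lemma stack_cong: "s ''A'' = s' ''A'' \<Longrightarrow> s ''K'' = s' ''K'' \<Longrightarrow> s ''s'' 0 = s' ''s'' 0 \<Longrightarrow> stack n s = stack n s'"
  by (simp add: stack_def frame_def)

lemma stack_Suc:
  assumes "s' ''s'' 0 = Suc (s ''s'' 0)" "\<And>i. i < s ''s'' 0 \<Longrightarrow> frame n s' i = frame n s i"
  shows "stack n s' = stack n s @ [frame n s' (s ''s'' 0)]"
  using assms by (simp add: stack_def)

lemma runs_pop:
  assumes "ok n s" "s ''B'' 0 = s ''s'' 0 * n" "s ''s'' 0 \<noteq> 0"
  shows "runs n pop_prog s (\<lambda>s'. s' ''B'' 0 = s' ''s'' 0 * n \<and> stack n s = stack n s' @ [(alive n s', s' ''u'' 0)])"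
proof -
  define i where "i = s ''s'' 0 - 1"
  have i: "s ''s'' 0 = Suc i" and B: "s ''B'' 0 - n = i * n" using assms(2,3) by (auto simp: i_def diff_mult_distrib)
  have nn: "s ''n'' 0 = n" and cap: "\<And>a j. s a j \<le> cap n" using assms(1) by (auto simp: ok_def)
  have capi: "i \<le> cap n" "i * n \<le> cap n"
    using cap[of "''s''" 0] cap[of "''B''" 0] i assms(2) by simp_all
  let ?rest = "for_loop ''v'' (Store ''c'' (Var ''v'') (Load ''A'' (Add (Var ''B'') (Var ''v''))))"
  let ?s3 = "set_var (set_var (set_var s ''s'' i) ''B'' (i * n)) ''u'' (s ''K'' i)"
  let ?Q = "\<lambda>s'. s' ''B'' 0 = s' ''s'' 0 * n \<and> stack n s = stack n s' @ [(alive n s', s' ''u'' 0)]"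
  have loop: "runs n ?rest ?s3 ?Q" if ok3: "ok n ?s3"
  proof (rule runs_for[where I = "\<lambda>j s'. \<forall>v<j. s' ''c'' v = s ''A'' (i * n + v)"])
    fix j s1 assume 1: "j < n" "ok n s1" "s1 ''v'' 0 = j" "\<forall>v<j. s1 ''c'' v = s ''A'' (i * n + v)"
      "same_except (insert ''v'' (writes (Store ''c'' (Var ''v'') (Load ''A'' (Add (Var ''B'') (Var ''v'')))))) ?s3 s1"
    then have "s1 ''B'' 0 = i * n" "s1 ''A'' = s ''A''" by simp_all
    then show "runs n (Store ''c'' (Var ''v'') (Load ''A'' (Add (Var ''B'') (Var ''v'')))) s1
       (\<lambda>s''. \<forall>v<Suc j. set_var s'' ''v'' (Suc j) ''c'' v = s ''A'' (i * n + v))"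
      using 1(3,4) cap by (intro runs_Store[OF 1(2)]) (simp_all add: less_Suc_eq)
  next
    fix s' assume 1: "\<forall>v<n. s' ''c'' v = s ''A'' (i * n + v)"
      "same_except (insert ''v'' (writes (Store ''c'' (Var ''v'') (Load ''A'' (Add (Var ''B'') (Var ''v'')))))) ?s3 s'"
    have s': "s' ''B'' 0 = i * n" "s' ''s'' 0 = i" "s' ''u'' 0 = s ''K'' i" "s' ''A'' = s ''A''" "s' ''K'' = s ''K''"
      using 1(2) by simp_all
    have "stack n s = stack n s' @ [frame n s (s' ''s'' 0)]"
      by (rule stack_Suc) (use s' i in \<open>simp_all add: frame_def\<close>)
    moreover have "frame n s (s' ''s'' 0) = (alive n s', s' ''u'' 0)"
      using 1(1) s' by (auto simp: frame_def alive_def)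
    ultimately show "?Q s'" using s' by simp
  qed (use ok3 in auto)
  show ?thesis
    unfolding pop_prog_def
  proof (rule runs_Seq[OF runs_Store])
    fix s1 assume 1: "ok n s1" "s1 = set_var s ''s'' i"
    show "runs n (Seq (Store ''B'' (Const 0) (Sub (Var ''B'') (Var ''n'')))
        (Seq (Store ''u'' (Const 0) (Load ''K'' (Var ''s''))) ?rest)) s1 ?Q"
    proof (rule runs_Seq[OF runs_Store])
      fix s2 assume 2: "ok n s2" "s2 = set_var (set_var s ''s'' i) ''B'' (i * n)"
      show "runs n (Seq (Store ''u'' (Const 0) (Load ''K'' (Var ''s''))) ?rest) s2 ?Q"
      proof (rule runs_Seq[OF runs_Store])
        fix s3 assume 3: "ok n s3" "s3 = ?s3"
        show "runs n ?rest s3 ?Q" unfolding 3(2) by (rule loop) (use 3 in simp)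
      qed (use 2 cap in simp_all)
    qed (use 1 B nn capi in simp_all)
  qed (use assms(1) i capi in simp_all)
qed

lemma runs_push:
  assumes "ok n s" "s ''B'' 0 = s ''s'' 0 * n" "s x 0 < n" "x \<notin> {''v'', ''A'', ''K'', ''s'', ''B''}"
    and bound: "Suc (s ''s'' 0) \<le> 2 * 7 ^ n"
  shows "runs n (push_prog x) s (\<lambda>s'. s' ''B'' 0 = s' ''s'' 0 * n \<and>
     stack n s' = stack n s @ [(alive n s - {s x 0}, s ''u'' 0 - 1)])"
proof -
  define i where "i = s ''s'' 0"
  have i: "s ''s'' 0 = i" "s ''B'' 0 = i * n" using assms(2) by (auto simp: i_def)
  have nn: "s ''n'' 0 = n" and cap: "\<And>a j. s a j \<le> cap n" using assms(1) by (auto simp: ok_def)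
  have capi: "Suc i \<le> cap n" "Suc i * n \<le> cap n"
    using length_le_cap[OF bound] i by simp_all
  let ?copy = "Store ''A'' (Add (Var ''B'') (Var ''v'')) (Load ''c'' (Var ''v''))"
  let ?Q = "\<lambda>s'. s' ''B'' 0 = s' ''s'' 0 * n \<and> stack n s' = stack n s @ [(alive n s - {s x 0}, s ''u'' 0 - 1)]"
  let ?p4 = "Store ''B'' (Const 0) (Add (Var ''B'') (Var ''n''))"
  let ?p3 = "Seq (Store ''s'' (Const 0) (Add (Var ''s'') (Const 1))) ?p4"
  let ?p2 = "Seq (Store ''K'' (Var ''s'') (Sub (Var ''u'') (Const 1))) ?p3"
  show ?thesis
    unfolding push_prog_def
  proof (rule runs_Seq[OF runs_for[where I = "\<lambda>j s'. (\<forall>v<j. s' ''A'' (i * n + v) = s ''c'' v) \<and>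
        (\<forall>l < i * n. s' ''A'' l = s ''A'' l)"]])
    fix j s1 assume 1: "j < n" "ok n s1" "s1 ''v'' 0 = j"
      "(\<forall>v<j. s1 ''A'' (i * n + v) = s ''c'' v) \<and> (\<forall>l < i * n. s1 ''A'' l = s ''A'' l)"
      "same_except (insert ''v'' (writes ?copy)) s s1"
    then have "s1 ''B'' 0 = i * n" "s1 ''c'' = s ''c''" using i by simp_all
    then show "runs n ?copy s1 (\<lambda>s''. (\<forall>v<Suc j. set_var s'' ''v'' (Suc j) ''A'' (i * n + v) = s ''c'' v) \<and>
        (\<forall>l < i * n. set_var s'' ''v'' (Suc j) ''A'' l = s ''A'' l))"
      using 1(3,4) cap by (intro runs_Store[OF 1(2)]) (simp_all add: less_Suc_eq)
  next
    fix s1 assume ok1: "ok n s1" and same1: "same_except (writes (for_loop ''v'' ?copy)) s s1"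
      and A1: "(\<forall>v<n. s1 ''A'' (i * n + v) = s ''c'' v) \<and> (\<forall>l < i * n. s1 ''A'' l = s ''A'' l)"
    have 1: "s1 ''B'' 0 = i * n" "s1 x 0 = s x 0" "s1 ''s'' 0 = i" "s1 ''u'' = s ''u''" "s1 ''K'' = s ''K''"
        "s1 ''n'' 0 = n"
      using same1 i assms(4) nn by simp_all
    show "runs n (Seq (Store ''A'' (Add (Var ''B'') (Var x)) (Const 0)) ?p2) s1 ?Q"
    proof (rule runs_Seq[OF runs_Store])
      fix s2 assume 2: "ok n s2" "s2 = s1(''A'' := (s1 ''A'')(i * n + s x 0 := 0))"
      show "runs n ?p2 s2 ?Q"
      proof (rule runs_Seq[OF runs_Store])
        fix s3 assume 3: "ok n s3" "s3 = s2(''K'' := (s2 ''K'')(i := s ''u'' 0 - 1))"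
        show "runs n ?p3 s3 ?Q"
        proof (rule runs_Seq[OF runs_Store])
          fix s4 assume 4: "ok n s4" "s4 = set_var s3 ''s'' (Suc i)"
          show "runs n ?p4 s4 ?Q"
          proof (rule runs_Store)
            let ?s5 = "s4(''B'' := (s4 ''B'')(val (Const 0) s4 := val (Add (Var ''B'') (Var ''n'')) s4))"
            have 5: "?s5 ''B'' 0 = Suc i * n" "?s5 ''s'' 0 = Suc i" "?s5 ''A'' = (s1 ''A'')(i * n + s x 0 := 0)"
               "?s5 ''K'' = (s ''K'')(i := s ''u'' 0 - 1)"
              using 1 2 3 4 by simp_all
            have fr: "frame n ?s5 i = (alive n s - {s x 0}, s ''u'' 0 - 1)"
              using A1 unfolding frame_def 5 by (auto simp: alive_def)
            have "stack n ?s5 = stack n s @ [frame n ?s5 (s ''s'' 0)]"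
            proof (rule stack_Suc)
              show "?s5 ''s'' 0 = Suc (s ''s'' 0)" using 5 i by simp
              fix l assume "l < s ''s'' 0"
              then have l: "l * n + v < i * n" if "v < n" for v
                using that i(1) index_lt by simp
              then have "?s5 ''A'' (l * n + v) = s ''A'' (l * n + v)" if "v < n" for v
                using that A1 unfolding 5 by (metis (no_types) fun_upd_other not_add_less1)
              then show "frame n ?s5 l = frame n s l"
                using \<open>l < s ''s'' 0\<close> i unfolding frame_def 5(4) by auto
            qed
            then show "?Q ?s5" using fr 5 i by simp
            show "val (Add (Var ''B'') (Var ''n'')) s4 \<le> cap n"
              using capi 1 2 3 4 by simp
          qed (use 4 in simp_all)
        qed (use 3 2 1 capi in simp_all)
      qed (use 2 1 cap[of "''u''" 0] in simp_all)
    qed (use ok1 1 in simp_all)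
  qed (use assms(1) in simp_all)
qed

lemma runs_push_all:
  assumes "ok n s" "s ''B'' 0 = s ''s'' 0 * n" "\<forall>x \<in> set xs. s x 0 < n"
    "set xs \<inter> {''v'', ''A'', ''K'', ''s'', ''B''} = {}" "s ''s'' 0 + length xs \<le> 2 * 7 ^ n"
  shows "runs n (push_all xs) s (\<lambda>s'. s' ''B'' 0 = s' ''s'' 0 * n \<and>
     stack n s' = stack n s @ map (\<lambda>x. (alive n s - {s x 0}, s ''u'' 0 - 1)) xs)"
  using assms
proof (induction xs arbitrary: s)
  case Nil
  then show ?case by (simp add: runs_Skip)
next
  case (Cons x xs)
  show ?case
    unfolding push_all.simps
  proof (rule runs_Seq[OF runs_push])
    fix s1 assume 1: "ok n s1" "same_except (writes (push_prog x)) s s1"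
      "s1 ''B'' 0 = s1 ''s'' 0 * n \<and> stack n s1 = stack n s @ [(alive n s - {s x 0}, s ''u'' 0 - 1)]"
    have same: "s1 a = s a" if "a \<notin> {''v'', ''A'', ''K'', ''s'', ''B''}" for a
      using 1(2) that by (simp add: push_prog_def)
    have len: "s1 ''s'' 0 = Suc (s ''s'' 0)"
      using arg_cong[OF conjunct2[OF 1(3)], of length] by simp
    have xs: "s1 y = s y" if "y \<in> set xs" for y
      using that Cons.prems(4) by (intro same) auto
    show "runs n (push_all xs) s1 (\<lambda>s'. s' ''B'' 0 = s' ''s'' 0 * n \<and>
       stack n s' = stack n s @ map (\<lambda>x. (alive n s - {s x 0}, s ''u'' 0 - 1)) (x # xs))"
    proof (rule runs_conseq[OF Cons.IH])
      fix s' assume "s' ''B'' 0 = s' ''s'' 0 * n \<and>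
        stack n s' = stack n s1 @ map (\<lambda>x. (alive n s1 - {s1 x 0}, s1 ''u'' 0 - 1)) xs"
      then show "s' ''B'' 0 = s' ''s'' 0 * n \<and>
        stack n s' = stack n s @ map (\<lambda>x. (alive n s - {s x 0}, s ''u'' 0 - 1)) (x # xs)"
        using 1(3) xs same[of "''u''"] same[of "''c''"] by (simp add: alive_def)
    qed (use 1 Cons.prems len xs in auto)
  qed (use Cons.prems in auto)
qed

section \<open>The search loop: invariant, potential and running time\<close>

context branching
begin

definition stack_solvable :: "store \<Rightarrow> bool" where
  "stack_solvable s \<longleftrightarrow> (\<exists>(X, b) \<in> set (stack n s). solvable b X)"

definition stack_weight :: "store \<Rightarrow> nat" where
  "stack_weight s = (\<Sum>(X, b) \<leftarrow> stack n s. weight b)"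

text \<open>Every frame weighs at least 1, so a bound on the potential is also a bound on the height
  of the stack.\<close>

lemma length_le_weight: "s ''s'' 0 \<le> stack_weight s"
proof -
  have "length xs \<le> (\<Sum>(X, b) \<leftarrow> xs. weight b)" for xs :: "(nat set \<times> nat) list"
  proof (induction xs)
    case (Cons p xs)
    then show ?case using weight_pos[of "snd p"] by (simp add: case_prod_beta)
  qed simp
  from this[of "stack n s"] show ?thesis by (simp add: stack_weight_def)
qed

text \<open>The bound \<open>2 * 7 ^ n\<close> serves space, not time: it limits the height of the
  stack and thereby keeps all addresses within \<open>cap n\<close>. The number of rounds is
  governed by the initial weight, which depends on \<open>k\<close>.\<close>

definition loop_inv :: "bool \<Rightarrow> store \<Rightarrow> bool" where
  "loop_inv answer s \<longleftrightarrow> ctx s \<and> s ''B'' 0 = s ''s'' 0 * n \<and> stack_weight s \<le> 2 * 7 ^ n \<and>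
     (answer \<longleftrightarrow> s ''out'' 0 \<noteq> 0 \<or> stack_solvable s)"

lemma stack_inv_cong:
  assumes "stack n s = stack n s'"
  shows "stack_weight s = stack_weight s'" "stack_solvable s = stack_solvable s'" "s ''s'' 0 = s' ''s'' 0"
proof -
  show "stack_weight s = stack_weight s'" "stack_solvable s = stack_solvable s'"
    using assms by (simp_all add: stack_weight_def stack_solvable_def)
  show "s ''s'' 0 = s' ''s'' 0" using arg_cong[OF assms, of length] by simp
qed

lemma runs_node:
  assumes inv: "loop_inv answer s" and "ok n s" "s ''s'' 0 \<noteq> 0"
  shows "runs n node_prog s (\<lambda>s'. loop_inv answer s' \<and> stack_weight s' < stack_weight s)"
  unfolding node_prog_def
proof (rule runs_Seq[OF runs_pop])
  fix s1 assume 1: "ok n s1" "same_except (writes pop_prog) s s1"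
    "s1 ''B'' 0 = s1 ''s'' 0 * n \<and> stack n s = stack n s1 @ [(alive n s1, s1 ''u'' 0)]"
  define X b where "X = alive n s1" and "b = s1 ''u'' 0"
  have ctx1: "ctx s1" and out1: "s1 ''out'' = s ''out''"
    using inv 1(2) by (simp_all add: loop_inv_def ctx_def pop_prog_def)
  have weight1: "stack_weight s = stack_weight s1 + weight b"
    and solv1: "stack_solvable s \<longleftrightarrow> stack_solvable s1 \<or> solvable b X"
    using 1(3) by (auto simp: stack_weight_def stack_solvable_def X_def b_def)
  have le: "stack_weight s1 + weight b \<le> 2 * 7 ^ n"
    and ans: "answer \<longleftrightarrow> s ''out'' 0 \<noteq> 0 \<or> stack_solvable s1 \<or> solvable b X"
    using inv weight1 solv1 by (auto simp: loop_inv_def)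
  let ?Q = "\<lambda>s'. loop_inv answer s' \<and> stack_weight s' < stack_weight s"
  let ?xs = "[''1'', ''2'', ''3'', ''4'', ''5'', ''6'', ''7'']"
  let ?p3 = "IfNZ (Var ''r'') (IfNZ (Var ''u'') (push_all ?xs) Skip) (Store ''out'' (Const 0) (Const 1))"
  show "runs n (Seq reach_prog (Seq (check pair_fm) ?p3)) s1 ?Q"
  proof (rule runs_Seq[OF runs_reach[OF 1(1) ctx1]])
    fix s2 assume 2: "ok n s2" "same_except (writes reach_prog) s1 s2"
      "\<forall>u<n. \<forall>v<n. s2 ''p'' (u * n + v) \<noteq> 0 \<longleftrightarrow> thin_reach n (alive n s1) u v"
    have ctx2: "ctx s2" and X2: "alive n s2 = X"
      and eq2: "s2 ''out'' = s ''out''" "s2 ''B'' = s1 ''B''" "s2 ''A'' = s1 ''A''" "s2 ''K'' = s1 ''K''"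
        "s2 ''s'' = s1 ''s''" "s2 ''u'' = s1 ''u''"
      using ctx1 2(2) out1 by (simp_all add: ctx_def alive_def X_def reach_prog_def)
    show "runs n (Seq (check pair_fm) ?p3) s2 ?Q"
    proof (rule runs_Seq[OF runs_pair[OF 2(1) ctx2]])
      show "\<forall>u<n. \<forall>v<n. s2 ''p'' (u * n + v) \<noteq> 0 \<longleftrightarrow> thin_reach n (alive n s2) u v"
        using 2(3) X2 X_def by simp
      fix s3 assume 3: "ok n s3" "same_except (writes (check pair_fm)) s2 s3"
        "if s3 ''r'' 0 = 0 then good (alive n s2) else bad_pair n (alive n s2) (s3 ''1'' 0) (s3 ''2'' 0)
           (s3 ''3'' 0) (s3 ''4'' 0) (s3 ''5'' 0) (s3 ''6'' 0) (s3 ''7'' 0)"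
      have ctx3: "ctx s3" and X3: "alive n s3 = X"
        and eq3: "s3 ''out'' = s ''out''" "s3 ''B'' 0 = s3 ''s'' 0 * n" "s3 ''A'' = s1 ''A''" "s3 ''K'' = s1 ''K''"
          "s3 ''s'' = s1 ''s''" "s3 ''u'' 0 = b"
        using ctx2 3(2) X2 eq2 1(3) by (simp_all add: ctx_def alive_def b_def)
      have stack3: "stack n s3 = stack n s1" by (rule stack_cong) (use eq3 in simp_all)
      note st3 = stack_inv_cong[OF stack3]
      show "runs n ?p3 s3 ?Q"
      proof (rule runs_If[OF 3(1)])
        assume "val (Var ''r'') s3 = 0"
        then have "solvable b X" using 3(3) X2 by (auto intro: solvable_good)
        then have answer using ans by simp
        show "runs n (Store ''out'' (Const 0) (Const 1)) s3 ?Q"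
        proof (rule runs_Store[OF 3(1)])
          let ?s4 = "s3(''out'' := (s3 ''out'')(val (Const 0) s3 := val (Const 1) s3))"
          have "stack n ?s4 = stack n s1" using stack3 by (subst stack_cong[of ?s4 s3]) simp_all
          note st4 = stack_inv_cong[OF this]
          show "?Q ?s4"
            using \<open>answer\<close> ctx3 st4 eq3 le weight1 weight_pos[of b] by (simp add: loop_inv_def)
        qed (simp_all add: one_le_cap)
      next
        assume "val (Var ''r'') s3 \<noteq> 0"
        then have bad: "bad_pair n X (s3 ''1'' 0) (s3 ''2'' 0) (s3 ''3'' 0) (s3 ''4'' 0) (s3 ''5'' 0) (s3 ''6'' 0) (s3 ''7'' 0)"
          using 3(3) X2 by simp
        have branch: "solvable b X \<longleftrightarrow> 0 < b \<and> (\<exists>x \<in> set ?xs. solvable (b - 1) (X - {s3 x 0}))"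
          unfolding bad_pair_branch[OF bad] by auto
        show "runs n (IfNZ (Var ''u'') (push_all ?xs) Skip) s3 ?Q"
        proof (rule runs_If[OF 3(1)])
          assume "val (Var ''u'') s3 = 0"
          then have "\<not> solvable b X" using branch eq3 by simp
          then show "runs n Skip s3 ?Q"
            using ans ctx3 st3 eq3 le weight1 weight_pos[of b]
            by (intro runs_Skip 3(1)) (simp add: loop_inv_def)
        next
          assume "val (Var ''u'') s3 \<noteq> 0"
          then have b: "0 < b" using eq3 by simp
          \<comment> \<open>The popped node weighed at least 7, which leaves room for seven
            frames.\<close>
          have seven: "s3 ''s'' 0 + 7 \<le> 2 * 7 ^ n"
          proof -
            have "7 \<le> weight b" using weight_branch[OF b] weight_pos[of "b - 1"] by linarith
            then show ?thesis using le length_le_weight[of s1] st3 by linarith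
          qed
          show "runs n (push_all ?xs) s3 ?Q"
          proof (rule runs_conseq[OF runs_push_all])
            fix s4 assume 4: "ok n s4" "same_except (writes (push_all ?xs)) s3 s4"
              "s4 ''B'' 0 = s4 ''s'' 0 * n \<and>
                 stack n s4 = stack n s3 @ map (\<lambda>x. (alive n s3 - {s3 x 0}, s3 ''u'' 0 - 1)) ?xs"
            have same: "s4 a = s3 a" if "a \<notin> {''v'', ''A'', ''K'', ''s'', ''B''}" for a
              using 4(2) that writes_push_all by blast
            have ctx4: "ctx s4" and out4: "s4 ''out'' = s ''out''"
              using ctx3 same eq3 by (simp_all add: ctx_def)
            have "stack_weight s4 = stack_weight s1 + 7 * weight (b - 1)"
              using 4(3) stack3 eq3 by (simp add: stack_weight_def)
            \<comment> \<open>The seven children weigh exactly one unit less than their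
              parent.\<close>
            then have "stack_weight s4 + 1 = stack_weight s"
              using weight_branch[OF b] weight1 by simp
            moreover have "stack_solvable s4 \<longleftrightarrow> stack_solvable s1 \<or> solvable b X"
              unfolding branch using 4(3) stack3 eq3 X3 b by (auto simp: stack_solvable_def)
            ultimately show "?Q s4"
              using ctx4 out4 4(3) ans le weight1 by (auto simp: loop_inv_def)
          qed (use 3(1) eq3 bad_pair_lt[of s3] bad X3 seven in auto)
        qed
      qed
    qed
  qed
qed (use assms in \<open>auto simp: loop_inv_def\<close>)

lemma runs_init:
  assumes "ok n s" "s ''m'' 0 = 0" and adj: "\<forall>u<n. \<forall>v<n. s ''adj'' (u * n + v) \<noteq> 0 \<longleftrightarrow> E u v"
  shows "runs n init_prog s (\<lambda>s'. ctx s' \<and> s' ''B'' 0 = s' ''s'' 0 * n \<and> stack n s' = [({..<n}, s ''k'' 0)])"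
proof -
  let ?row = "Store ''m'' (Add (Var ''v'') (Const 1)) (Add (Load ''m'' (Var ''v'')) (Var ''n''))"
  let ?one = "Store ''A'' (Var ''v'') (Const 1)"
  let ?p4 = "Seq (Store ''s'' (Const 0) (Const 1)) (Store ''B'' (Const 0) (Var ''n''))"
  let ?p3 = "Seq (Store ''K'' (Const 0) (Var ''k'')) ?p4"
  let ?Q = "\<lambda>s'. ctx s' \<and> s' ''B'' 0 = s' ''s'' 0 * n \<and> stack n s' = [({..<n}, s ''k'' 0)]"
  have n7: "n \<le> 2 * 7 ^ n"
  proof -
    have "n < 2 ^ n" by simp
    then show ?thesis using power_mono[of "2::nat" 7 n] by linarith
  qed
  show ?thesis
    unfolding init_prog_def
  proof (rule runs_Seq[OF runs_for[where I = "\<lambda>j s'. \<forall>v\<le>j. s' ''m'' v = v * n"]])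
    fix j s1 assume 1: "j < n" "ok n s1" "s1 ''v'' 0 = j" "\<forall>v\<le>j. s1 ''m'' v = v * n"
    have "Suc j * n \<le> cap n" using 1(1) n7 by (intro length_le_cap) simp
    then show "runs n ?row s1 (\<lambda>s''. \<forall>v\<le>Suc j. set_var s'' ''v'' (Suc j) ''m'' v = v * n)"
      using 1 by (intro runs_Store[OF 1(2)]) (auto simp: ok_def le_Suc_eq)
  next
    fix s1 assume 1: "ok n s1" "\<forall>v\<le>n. s1 ''m'' v = v * n" "same_except (writes (for_loop ''v'' ?row)) s s1"
    have ctx1: "ctx s1" and k1: "s1 ''k'' = s ''k''"
      using 1 adj by (simp_all add: ctx_def ok_def)
    show "runs n (Seq (for_loop ''v'' ?one) ?p3) s1 ?Q"
    proof (rule runs_Seq[OF runs_for[where I = "\<lambda>j s'. \<forall>v<j. s' ''A'' v = 1"]])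
      fix j s2 assume "j < n" "ok n s2" "s2 ''v'' 0 = j" "\<forall>v<j. s2 ''A'' v = 1"
      then show "runs n ?one s2 (\<lambda>s''. \<forall>v<Suc j. set_var s'' ''v'' (Suc j) ''A'' v = 1)"
        by (intro runs_Store) (auto simp: one_le_cap less_Suc_eq)
    next
      fix s2 assume 2: "ok n s2" "\<forall>v<n. s2 ''A'' v = 1" "same_except (writes (for_loop ''v'' ?one)) s1 s2"
      have ctx2: "ctx s2" and k2: "s2 ''k'' = s ''k''"
        using 2(3) ctx1 k1 by (simp_all add: ctx_def)
      show "runs n ?p3 s2 ?Q"
      proof (rule runs_Seq[OF runs_Store])
        fix s3 assume 3: "ok n s3" "s3 = set_var s2 ''K'' (s ''k'' 0)"
        show "runs n ?p4 s3 ?Q"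
        proof (rule runs_Seq[OF runs_Store])
          fix s4 assume 4: "ok n s4" "s4 = set_var s3 ''s'' 1"
          show "runs n (Store ''B'' (Const 0) (Var ''n'')) s4 ?Q"
          proof (rule runs_Store)
            have n4: "s4 ''n'' 0 = n" using 4 by (simp add: ok_def)
            then show "val (Var ''n'') s4 \<le> cap n" by (simp add: le_cap)
            show "?Q (s4(''B'' := (s4 ''B'')(val (Const 0) s4 := val (Var ''n'') s4)))"
              using n4 2(2) ctx2 unfolding 4(2) 3(2) by (auto simp: stack_def frame_def)
          qed (use 4 in simp_all)
        qed (use 3 in \<open>simp_all add: one_le_cap\<close>)
      qed (use 2(1) k2 assms(1) in \<open>simp_all add: ok_def\<close>)
    qed (use 1(1) in simp_all)
  qed (use assms in simp_all)
qed

text \<open>The loop ends with an empty stack, on which \<open>stack_solvable\<close> is false, so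
  the invariant reduces the answer to \<open>out\<close>.\<close>

lemma exec_main:
  assumes "ok n s" "s ''m'' 0 = 0" "s ''out'' 0 = 0" "s ''k'' 0 = k" "k \<le> n"
    and adj: "\<forall>u<n. \<forall>v<n. s ''adj'' (u * n + v) \<noteq> 0 \<longleftrightarrow> E u v"
  shows "\<exists>t s'. exec (Seq init_prog (WhileNZ (Var ''s'') node_prog)) s t s' \<and>
     t \<le> (n + 2) ^ prog_deg init_prog + 2 * 7 ^ k * (n + 2) ^ (expr_deg (Var ''s'') + prog_deg node_prog + 2) \<and>
     (s' ''out'' 0 \<noteq> 0 \<longleftrightarrow> solvable k {..<n})"
proof -
  let ?D = "expr_deg (Var ''s'') + prog_deg node_prog + 2"
  obtain t1 s1 where 1: "exec init_prog s t1 s1" "t1 \<le> (n + 2) ^ prog_deg init_prog" "ok n s1" "ctx s1"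
      "s1 ''B'' 0 = s1 ''s'' 0 * n" "stack n s1 = [({..<n}, k)]"
    using runs_init[OF assms(1,2) adj] assms(4) unfolding runs_def by blast
  have "s1 ''out'' = s ''out''"
    by (rule exec_writes[OF 1(1)]) (simp add: init_prog_def)
  moreover have w: "stack_weight s1 = weight k" and "stack_solvable s1 = solvable k {..<n}"
    using 1(6) by (simp_all add: stack_weight_def stack_solvable_def)
  moreover have "weight k \<le> 2 * 7 ^ n"
  proof -
    have "(7::nat) ^ k \<le> 7 ^ n" using assms(5) by (intro power_increasing) auto
    then show ?thesis using weight_le[of k] by linarith
  qed
  ultimately have "loop_inv (solvable k {..<n}) s1"
    using 1 assms(3) by (simp add: loop_inv_def)
  then obtain t2 s2 where 2: "exec (WhileNZ (Var ''s'') node_prog) s1 t2 s2"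
      "t2 \<le> (stack_weight s1 + 1) * (n + 2) ^ ?D" "loop_inv (solvable k {..<n}) s2" "val (Var ''s'') s2 = 0"
    using while_potential[of "loop_inv (solvable k {..<n})" n "Var ''s''" node_prog stack_weight s1]
      runs_node 1(3) by auto
  have "(stack_weight s1 + 1) * (n + 2) ^ ?D \<le> 2 * 7 ^ k * (n + 2) ^ ?D"
    using weight_le[of k] w by (intro mult_le_mono1) simp
  then have "t1 + t2 \<le> (n + 2) ^ prog_deg init_prog + 2 * 7 ^ k * (n + 2) ^ ?D"
    using 1(2) 2(2) by (meson add_mono order_trans)
  moreover have "s2 ''out'' 0 \<noteq> 0 \<longleftrightarrow> solvable k {..<n}"
    using 2(3,4) by (auto simp: loop_inv_def stack_solvable_def stack_def)
  ultimately show ?thesis using exec.Seq[OF 1(1) 2(1)] by blast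
qed

end

section \<open>The two budget ranges and the final bound\<close>

lemma log_cost_linear: "log_cost v \<le> v + 1"
  unfolding log_cost_def using floorlog_leI[of v 2 v] by (simp add: less_exp)

lemma decides_large_budget:
  assumes "pair_graph G" "pverts G = {..<n}" "n \<le> k"
  shows "decides_within deletion_prog (graph_input n G k) (14 * 7 ^ k)
    (\<exists>S. claw_or_triangle_free_deletion_set (with_proj G) S \<and> card S \<le> k)"
proof -
  interpret pair_graph G by (rule assms(1))
  interpret sym_irrefl edge by (rule sym_irrefl_edge)
  have "good {}" by (auto simp: good_def tri_def adj_def)
  then have "solvable k (pverts G)"
    unfolding solvable_def assms(2) using assms(3) by (intro exI[of _ "{..<n}"]) simp
  then have ans: "\<exists>S. claw_or_triangle_free_deletion_set (with_proj G) S \<and> card S \<le> k"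
    using deletion_iff_solvable by blast
  let ?s = "graph_input n G k"
  let ?e = "Sub (Var ''n'') (Var ''k'')"
  have nk: "?s ''n'' 0 = n" "?s ''k'' 0 = k" by (simp_all add: graph_input_def)
  have "expr_cost ?e ?s \<le> n + k + 5"
    using log_cost_linear[of n] log_cost_linear[of k] log_cost_linear[of 0] assms(3) by (simp add: nk)
  then have "1 + expr_cost ?e ?s + (1 + expr_cost (Const 0) ?s + expr_cost (Const 1) ?s) \<le> 2 * k + 10"
    using log_cost_linear[of 0] log_cost_linear[of 1] assms(3) by simp
  also have "\<dots> \<le> 14 * 7 ^ k" by (induction k) auto
  finally have "1 + expr_cost ?e ?s + (1 + expr_cost (Const 0) ?s + expr_cost (Const 1) ?s) \<le> 14 * 7 ^ k" .
  moreover have "exec deletion_prog ?s (1 + expr_cost ?e ?s + (1 + expr_cost (Const 0) ?s + expr_cost (Const 1) ?s))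
      (?s(''out'' := (?s ''out'')(val (Const 0) ?s := val (Const 1) ?s)))"
    unfolding deletion_prog_def by (rule exec.IfFalse[OF _ exec.Store]) (use nk assms(3) in simp)
  moreover have "(?s(''out'' := (?s ''out'')(val (Const 0) ?s := val (Const 1) ?s))) ''out'' 0 \<noteq> 0" by simp
  ultimately show ?thesis
    unfolding decides_within_def using ans by blast
qed

lemma ok_graph_input: "k \<le> n \<Longrightarrow> ok n (graph_input n G k)"
  by (simp add: ok_def graph_input_def le_cap one_le_cap)

lemma decides_small_budget:
  assumes "pair_graph G" "pverts G = {..<n}" "k < n"
  shows "decides_within deletion_prog (graph_input n G k)
    (5 * 7 ^ k * (n + 2) ^ (expr_deg (Sub (Var ''n'') (Var ''k'')) + prog_deg init_prog +
        (expr_deg (Var ''s'') + prog_deg node_prog + 2)))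
    (\<exists>S. claw_or_triangle_free_deletion_set (with_proj G) S \<and> card S \<le> k)"
proof -
  interpret G: pair_graph G by (rule assms(1))
  interpret branching G.edge n
    using G.sym_irrefl_edge assms(3) by (simp add: branching_def sym_irrefl_nat_def branching_axioms_def)
  let ?s = "graph_input n G k"
  let ?e = "Sub (Var ''n'') (Var ''k'')"
  let ?a = "expr_deg ?e" and ?b = "prog_deg init_prog" and ?c = "expr_deg (Var ''s'') + prog_deg node_prog + 2"
  have ok: "ok n ?s" using assms(3) by (simp add: ok_graph_input)
  have adj: "?s ''adj'' (u * n + v) \<noteq> 0 \<longleftrightarrow> G.edge u v" if "u < n" "v < n" for u v
  proof -
    have "(u * n + v) div n = u" "(u * n + v) mod n = v" using that by simp_all
    moreover have "u * n + v < n * n" using that by (intro index_lt)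
    ultimately show ?thesis by (simp add: graph_input_def)
  qed
  obtain t s' where *: "exec (Seq init_prog (WhileNZ (Var ''s'') node_prog)) ?s t s'"
      "t \<le> (n + 2) ^ ?b + 2 * 7 ^ k * (n + 2) ^ ?c" "s' ''out'' 0 \<noteq> 0 \<longleftrightarrow> solvable k {..<n}"
    using exec_main[OF ok] adj assms(3) by (force simp: graph_input_def)
  have "val ?e ?s \<noteq> 0" using assms(3) by (simp add: graph_input_def)
  then have ex: "exec deletion_prog ?s (1 + expr_cost ?e ?s + t) s'"
    unfolding deletion_prog_def using *(1) by (rule exec.IfTrue)
  have "expr_cost ?e ?s \<le> (n + 2) ^ ?a" using ok by (rule expr_cost_le)
  moreover have "(n + 2) ^ ?a \<le> (n + 2) ^ (?a + ?b + ?c)" "(n + 2) ^ ?b \<le> (n + 2) ^ (?a + ?b + ?c)"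
    "(n + 2) ^ ?c \<le> (n + 2) ^ (?a + ?b + ?c)" "1 \<le> (n + 2) ^ (?a + ?b + ?c)"
    by (rule power_increasing one_le_power; simp)+
  moreover have "2 * 7 ^ k * (n + 2) ^ ?c \<le> 2 * 7 ^ k * (n + 2) ^ (?a + ?b + ?c)"
    using calculation(4) by (rule mult_le_mono2)
  \<comment> \<open>One power each pays for the unit, the test and the initialisation; with the
    factor 2 of the loop this gives the constant 5.\<close>
  ultimately have "1 + expr_cost ?e ?s + t \<le> 3 * (n + 2) ^ (?a + ?b + ?c) + 2 * 7 ^ k * (n + 2) ^ (?a + ?b + ?c)"
    using *(2) by linarith
  also have "\<dots> \<le> 5 * 7 ^ k * (n + 2) ^ (?a + ?b + ?c)"
  proof -
    have "3 + 2 * 7 ^ k \<le> 5 * (7::nat) ^ k" using one_le_power[of "7::nat" k] by simp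
    from mult_le_mono1[OF this, of "(n + 2) ^ (?a + ?b + ?c)"] show ?thesis
      by (simp only: add_mult_distrib)
  qed
  finally show ?thesis
    unfolding decides_within_def G.deletion_iff_solvable assms(2) using ex *(3) by blast
qed

theorem theorem7:
  shows "\<exists>(p :: prog) (C :: nat) (d :: nat).
    \<forall>(G :: nat pair_pre_digraph) (n :: nat) (k :: nat).
      pair_graph G \<and> pverts G = {..<n} \<longrightarrow>
      decides_within p (graph_input n G k)
        (C * 7 ^ k * (max 1 n) ^ d)
        (\<exists>S. claw_or_triangle_free_deletion_set (with_proj G) S \<and> card S \<le> k)"
proof -
  define d where "d = expr_deg (Sub (Var ''n'') (Var ''k'')) + prog_deg init_prog +
        (expr_deg (Var ''s'') + prog_deg node_prog + 2)"
  have mono: "decides_within p s T' b" if "decides_within p s T b" "T \<le> T'" for p s T T' b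
    using that unfolding decides_within_def by (meson order_trans)
  have "decides_within deletion_prog (graph_input n G k) (14 * 3 ^ d * 7 ^ k * (max 1 n) ^ d)
      (\<exists>S. claw_or_triangle_free_deletion_set (with_proj G) S \<and> card S \<le> k)"
    if G: "pair_graph G" "pverts G = {..<n}" for G n k
  proof (cases "k < n")
    case True
    \<comment> \<open>Changing the base costs the factor \<open>3 ^ d\<close>; the 14 comes from the
      case of large budgets.\<close>
    have "(n + 2) ^ d \<le> (3 * max 1 n) ^ d" using True by (intro power_mono) auto
    then have "5 * 7 ^ k * (n + 2) ^ d \<le> 14 * 7 ^ k * (3 * max 1 n) ^ d"
      by (intro mult_le_mono) auto
    also have "\<dots> = 14 * 3 ^ d * 7 ^ k * (max 1 n) ^ d" by (simp add: power_mult_distrib)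
    finally show ?thesis
      using mono[OF decides_small_budget[OF G True, folded d_def]] by blast
  next
    case False
    have "1 \<le> 3 ^ d * (max 1 n) ^ d" by (cases "n = 0") (simp_all add: Suc_le_eq)
    from mult_le_mono2[OF this, of "14 * 7 ^ k"] have "14 * 7 ^ k \<le> 14 * 3 ^ d * 7 ^ k * (max 1 n) ^ d"
      by (simp add: mult_ac)
    then show ?thesis
      using mono[OF decides_large_budget[OF G]] False by (meson not_le)
  qed
  then show ?thesis by blast
qed

end
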